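(* Let $F$ be an algebraically closed field and let $I\subset F[x,y]$ be an ideal generated by a vector space $V$ of forms of degree $d$. Assume that the greatest common divisor of the forms in $V$ is $1$. For a subspace $V'\subset V$, let $r_{V'}$ be the degree of the greatest common divisor of the forms in $V'$, and let $$ r:=\max\{r_{V'} \mid V'\subset V \text{ a subspace of codimension } 1\}. $$ If $t\gg 0$, then $$ \operatorname{reg} I^t = dt+r-1 . $$
   Context: $F[x,y]$ is the standard graded polynomial ring, and $\operatorname{reg}$ denotes Castelnuovo-Mumford regularity of a finitely generated graded module over it. *)

theory Defs
  imports "HOL-Computational_Algebra.Computational_Algebra"
begin

text \<open>
  The ring \<open>F[x,y]\<close> is the type \<open>'a poly poly\<close>: the coefficient of \<open>x^j y^i\<close> in \<open>f\<close> is
  \<open>coeff (coeff f i) j\<close>.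
\<close>

definition var_x :: "'a::comm_ring_1 poly poly" where
  "var_x = [:[:0, 1:]:]"

definition var_y :: "'a::comm_ring_1 poly poly" where
  "var_y = [:0, 1:]"

text \<open>
  The graded component of integer degree \<open>e\<close>, including the zero polynomial; it is \<open>{0}\<close> for
  \<open>e < 0\<close>.
\<close>

definition forms :: "int \<Rightarrow> 'a::comm_ring_1 poly poly set" where
  "forms e = {f. \<forall>i j. coeff (coeff f i) j \<noteq> 0 \<longrightarrow> int (i + j) = e}"

text \<open>
  Multiplication of a polynomial by a scalar of \<open>F\<close>. The notions \<open>subspace\<close> and \<open>dim\<close> below are
  those of the library for this vector space.
\<close>

definition scalar :: "'a::comm_ring_1 \<Rightarrow> 'a poly poly \<Rightarrow> 'a poly poly" where
  "scalar c f = smult [:c:] f"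

lemma vector_space_scalar: "vector_space (scalar :: 'a::field \<Rightarrow> _)"
  by unfold_locales
    (simp_all add: scalar_def smult_add_right mult.commute flip: smult_add_left one_pCons)

abbreviation form_subspace :: "'a::field poly poly set \<Rightarrow> bool" where
  "form_subspace \<equiv> module.subspace scalar"

abbreviation form_dim :: "'a::field poly poly set \<Rightarrow> nat" where
  "form_dim \<equiv> vector_space.dim scalar"

text \<open>
  Ideals are the submodules of the ring regarded as a module over itself. The locale is not
  interpreted for multiplication, because its simplification rules would reassociate products.
\<close>

lemma module_times: "module ((*) :: 'a::comm_ring_1 \<Rightarrow> 'a \<Rightarrow> 'a)"
  by unfold_locales (simp_all add: algebra_simps)

abbreviation ideal_gen :: "'a::comm_ring_1 set \<Rightarrow> 'a set" where
  "ideal_gen \<equiv> module.span (*)"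

primrec ideal_power :: "'a::comm_ring_1 set \<Rightarrow> nat \<Rightarrow> 'a set" where
  "ideal_power I 0 = UNIV"
| "ideal_power I (Suc t) = ideal_gen {f * g | f g. f \<in> I \<and> g \<in> ideal_power I t}"

definition is_gcd_of :: "'a::comm_ring_1 \<Rightarrow> 'a set \<Rightarrow> bool" where
  "is_gcd_of g A \<longleftrightarrow> (\<forall>f\<in>A. g dvd f) \<and> (\<forall>h. (\<forall>f\<in>A. h dvd f) \<longrightarrow> h dvd g)"

text \<open>
  For a set \<open>A\<close> of forms of one degree, not all zero, a greatest common divisor is again a nonzero
  form, unique up to a nonzero scalar.
\<close>

definition gcd_degree :: "'a::field poly poly set \<Rightarrow> nat" where
  "gcd_degree A = (THE e. \<exists>g. g \<noteq> 0 \<and> is_gcd_of g A \<and> g \<in> forms (int e))"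

text \<open>
  A graded \<open>F[x,y]\<close>-module is given by its scalar multiplication \<open>scale\<close> and its homogeneous
  components \<open>M e\<close>, as subsets of an abelian group; the module itself is their direct sum.
  A minimal graded free resolution
  \<open>\<dots> \<rightarrow> F 1 \<rightarrow> F 0 \<rightarrow> M \<rightarrow> 0\<close> is given by
  \<^item> ranks \<open>n i\<close> and degrees \<open>a i k\<close>, where \<open>F i\<close> is free on generators \<open>k < n i\<close> and the
    \<open>k\<close>-th generator has degree \<open>a i k\<close>, so that
    \<open>F i\<close> is the direct sum of the \<open>S(- a i k)\<close> for \<open>S = F[x,y]\<close>;
  \<^item> the images \<open>g k\<close> in \<open>M\<close> of the generators of \<open>F 0\<close>;
  \<^item> the matrices \<open>\<phi> i\<close> of the maps \<open>F (i+1) \<rightarrow> F i\<close>, the \<open>k\<close>-th generator of \<open>F (i+1)\<close> being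
    sent to the vector with coordinates \<open>\<phi> i k l\<close>, \<open>l < n i\<close>.

  An element of \<open>F i\<close> is a function \<open>v\<close>, of which only the values \<open>v k\<close> with \<open>k < n i\<close> count.
  For surjectivity onto \<open>M\<close> it suffices that the homogeneous elements are attained. Minimality says
  that the entries of all \<open>\<phi> i\<close> lie in the ideal \<open>(x,y)\<close>. The ranks may vanish from some
  point on.
\<close>

definition minimal_graded_free_resolution ::
  "('a::field poly poly \<Rightarrow> 'b::ab_group_add \<Rightarrow> 'b) \<Rightarrow> (int \<Rightarrow> 'b set) \<Rightarrow>
   (nat \<Rightarrow> nat) \<Rightarrow> (nat \<Rightarrow> nat \<Rightarrow> int) \<Rightarrow> (nat \<Rightarrow> 'b) \<Rightarrow>
   (nat \<Rightarrow> nat \<Rightarrow> nat \<Rightarrow> 'a poly poly) \<Rightarrow> bool" where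
  "minimal_graded_free_resolution scale M n a g \<phi> \<longleftrightarrow>
     (\<forall>k<n 0. g k \<in> M (a 0 k)) \<and>
     (\<forall>i. \<forall>k<n (Suc i). \<forall>l<n i. \<phi> i k l \<in> forms (a (Suc i) k - a i l)) \<and>
     (\<forall>e. \<forall>m\<in>M e. \<exists>v. m = (\<Sum>k<n 0. scale (v k) (g k))) \<and>
     (\<forall>v. (\<Sum>k<n 0. scale (v k) (g k)) = 0 \<longleftrightarrow>
          (\<exists>w. \<forall>l<n 0. v l = (\<Sum>k<n 1. w k * \<phi> 0 k l))) \<and>
     (\<forall>i v. (\<forall>l<n i. (\<Sum>k<n (Suc i). v k * \<phi> i k l) = 0) \<longleftrightarrow>
          (\<exists>w. \<forall>k<n (Suc i). v k = (\<Sum>m<n (Suc (Suc i)). w m * \<phi> (Suc i) m k))) \<and>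
     (\<forall>i. \<forall>k<n (Suc i). \<forall>l<n i. \<phi> i k l \<in> ideal_gen {var_x, var_y})"

text \<open>
  The Castelnuovo-Mumford regularity of a nonzero finitely generated graded module is the maximum of
  \<open>a i k - i\<close> over all generators in a minimal graded free resolution.
\<close>

definition cm_regularity ::
  "('a::field poly poly \<Rightarrow> 'b::ab_group_add \<Rightarrow> 'b) \<Rightarrow> (int \<Rightarrow> 'b set) \<Rightarrow> int" where
  "cm_regularity scale M =
     (THE \<rho>. \<exists>n a g \<phi>. minimal_graded_free_resolution scale M n a g \<phi> \<and>
        (\<exists>i. \<exists>k<n i. \<rho> = a i k - int i) \<and>
        (\<forall>i. \<forall>k<n i. a i k - int i \<le> \<rho>))"

text \<open>A homogeneous ideal, as a graded module with the grading induced from \<open>F[x,y]\<close>.\<close>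

definition ideal_regularity :: "'a::field poly poly set \<Rightarrow> int" where
  "ideal_regularity J = cm_regularity (*) (\<lambda>e. J \<inter> forms e)"

end

theory Submission
  imports Defs
begin

text \<open>
  Write \<open>S = F[x,y]\<close>. Every ideal \<open>I\<^sup>t\<close> contains all forms of large degree, because \<open>V\<close> has no common
  factor. For a homogeneous ideal \<open>J\<close> of this kind the regularity is the first degree \<open>e\<^sub>0\<close> whose
  forms all lie in \<open>J\<close> (\<open>ideal_regularity_eq\<close>). This is proved with
  the Koszul relations of \<open>x, y\<close> alone: they show that second syzygies vanish, that generators
  have degree at most \<open>e\<^sub>0\<close> and relations degree at most \<open>e\<^sub>0 + 1\<close>, and that a form of degree
  \<open>e\<^sub>0 - 1\<close> outside \<open>J\<close> forces a relation of degree exactly \<open>e\<^sub>0 + 1\<close>. The same computations bound the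
  degrees in which generators and relations are needed, which gives the existence of a minimal
  resolution.

  It remains to see that, for large \<open>t\<close>, the ideal \<open>I\<^sup>t\<close> contains all forms of degree \<open>d t + r - 1\<close> but
  not all of degree \<open>d t + r - 2\<close>.

  For the second claim let \<open>p\<close> of degree \<open>r\<close> divide a hyperplane \<open>U\<close> of \<open>V\<close>, and let \<open>f\<close> span \<open>V\<close>
  modulo \<open>U\<close>. Then \<open>I\<^sup>t\<close> lies in \<open>(p, f\<^sup>t)\<close>. In degree \<open>d t + r - 2\<close> the quotient \<open>S/p\<close> has dimension
  \<open>r\<close>, and the multiples of \<open>f\<^sup>t\<close> by the \<open>r - 1\<close> monomials of degree \<open>r - 2\<close> do not fill it
  (\<open>forms_not_covered\<close>, \<open>forms_not_in_power\<close>).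

  For the first claim consider, for a subspace \<open>U\<close> of \<open>V\<close>, the spaces
  \<open>Q\<^sub>t = S / (I\<^sup>t + (U))\<close> in degree \<open>d t + r - 1\<close>, on which multiplication by \<open>V\<close> acts from \<open>Q\<^sub>t\<close> to
  \<open>Q\<close> at \<open>t + 1\<close>. That \<open>Q\<^sub>t\<close> vanishes for large \<open>t\<close> is proved by descending induction on \<open>U\<close>, the case
  \<open>U = 0\<close> being the claim. For a hyperplane \<open>U\<close> it is again a statement about \<open>(p, f\<^sup>t)\<close>, where now
  \<open>deg p \<le> r\<close> makes the multiples of \<open>f\<^sup>t\<close> sufficient (\<open>forms_in_power_mod_hyperplane\<close>). If \<open>U\<close> has
  codimension at least two, the induction hypothesis says that every \<open>l\<close> in \<open>V\<close> outside \<open>U\<close> acts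
  surjectively for large \<open>t\<close>. Then the dimension of \<open>Q\<^sub>t\<close> stabilises and every such \<open>l\<close> acts
  injectively for large \<open>t\<close>. For \<open>f, g\<close> independent modulo \<open>U\<close>, a linear dependence among the
  \<open>g\<^sup>i f\<^sup>m\<^sup>-\<^sup>i h\<close> is a binary form in \<open>f, g\<close> killing \<open>h\<close>; over an algebraically closed field it is a
  product of such \<open>l\<close>, so \<open>h = 0\<close> (\<open>pencil_quotient_vanishes\<close>). This takes the place of finding a
  closed point in the support of a sheaf on the projective space of \<open>V\<close>.

  Statements about forms modulo \<open>p\<close> are proved by splitting \<open>p\<close> into linear factors and removing
  them one at a time, evaluating at the corresponding point of the projective line.
\<close>

interpretation vs: vector_space "scalar :: 'a::field \<Rightarrow> _"
  by (rule vector_space_scalar)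

section \<open>Homogeneous components\<close>

lemma forms_zero [simp]: "0 \<in> forms e"
  by (simp add: forms_def)

lemma forms_add: "f \<in> forms e \<Longrightarrow> g \<in> forms e \<Longrightarrow> f + g \<in> forms e"
  unfolding forms_def by auto (metis add.right_neutral)

lemma forms_uminus: "f \<in> forms e \<Longrightarrow> - f \<in> forms e"
  by (simp add: forms_def)

lemma forms_diff: "f \<in> forms e \<Longrightarrow> g \<in> forms e \<Longrightarrow> f - g \<in> forms e"
  using forms_add[of f e "- g"] by (simp add: forms_uminus)

lemma forms_sum: "(\<And>i. i \<in> A \<Longrightarrow> f i \<in> forms e) \<Longrightarrow> sum f A \<in> forms e"
  by (induction A rule: infinite_finite_induct) (auto intro: forms_add)

lemma scalar_eq_mult: "scalar c f = [:[:c:]:] * f"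
  by (simp add: scalar_def)

lemma forms_scalar: "f \<in> forms e \<Longrightarrow> scalar c f \<in> forms e"
  unfolding forms_def scalar_def by (auto simp: coeff_smult) (metis mult_zero_right)

lemma form_subspace_forms: "form_subspace (forms e)"
  by (rule vs.subspaceI) (simp_all add: forms_add forms_scalar)

lemma coeff_coeff_mult:
  "coeff (coeff (f * g) i) j =
     (\<Sum>k\<le>i. \<Sum>l\<le>j. coeff (coeff f k) l * coeff (coeff g (i - k)) (j - l))"
  by (simp add: coeff_mult coeff_sum)

lemma forms_mult: "f \<in> forms a \<Longrightarrow> g \<in> forms b \<Longrightarrow> f * g \<in> forms (a + b)"
proof -
  assume f: "f \<in> forms a" and g: "g \<in> forms b"
  have "int (i + j) = a + b" if "coeff (coeff (f * g) i) j \<noteq> 0" for i j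
  proof -
    have "\<exists>k\<le>i. \<exists>l\<le>j. coeff (coeff f k) l * coeff (coeff g (i - k)) (j - l) \<noteq> 0"
    proof (rule ccontr)
      assume "\<not> ?thesis"
      then have "coeff (coeff (f * g) i) j = 0"
        unfolding coeff_coeff_mult by (intro sum.neutral ballI) auto
      then show False using that by simp
    qed
    then obtain k l where kl: "k \<le> i" "l \<le> j"
      "coeff (coeff f k) l * coeff (coeff g (i - k)) (j - l) \<noteq> 0"
      by blast
    then have "coeff (coeff f k) l \<noteq> 0" "coeff (coeff g (i - k)) (j - l) \<noteq> 0"
      by auto
    then have "int (k + l) = a" "int ((i - k) + (j - l)) = b"
      using f g unfolding forms_def mem_Collect_eq by blast+
    then show ?thesis using kl by linarith
  qed
  then show ?thesis by (auto simp: forms_def)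
qed

lemma forms_negative: "e < 0 \<Longrightarrow> forms e = {0}"
proof -
  assume "e < 0"
  then have "coeff (coeff f i) j = 0" if "f \<in> forms e" for f :: "'a poly poly" and i j
    using that unfolding forms_def by force
  then show ?thesis by (auto simp: poly_eq_iff)
qed

lemma const_in_forms: "[:[:c:]:] \<in> forms 0"
  by (auto simp: forms_def coeff_pCons split: nat.splits)

lemma one_in_forms: "1 \<in> forms 0"
  using const_in_forms[of 1] by (simp add: one_pCons)

lemma forms_power: "f \<in> forms a \<Longrightarrow> f ^ n \<in> forms (int n * a)"
proof (induction n)
  case 0
  then show ?case by (simp add: one_in_forms)
next
  case (Suc n)
  then have "f * f ^ n \<in> forms (a + int n * a)" by (intro forms_mult) auto
  then show ?case by (simp add: algebra_simps)
qed

lemma var_x_forms: "var_x \<in> forms 1"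
  by (auto simp: forms_def var_x_def coeff_pCons split: nat.splits)

lemma var_y_forms: "var_y \<in> forms 1"
  by (auto simp: forms_def var_y_def coeff_pCons split: nat.splits)

lemma var_y_mult: "var_y * f = pCons 0 f"
  by (simp add: var_y_def)

lemma var_x_mult: "var_x * f = smult [:0, 1:] f"
  by (simp add: var_x_def)

text \<open>
  The homogeneous component of degree \<open>e\<close>: the coefficient of \<open>y\<^sup>i\<close> keeps only its monomial
  \<open>x\<^sup>e\<^sup>-\<^sup>i\<close>. The case distinction is there because \<open>nat\<close> sends negative exponents to \<open>0\<close>.
\<close>

definition hcomp :: "int \<Rightarrow> 'a::comm_ring_1 poly poly \<Rightarrow> 'a poly poly" where
  "hcomp e f = (\<Sum>i\<le>degree f. monom (if e \<ge> int i then
      monom (coeff (coeff f i) (nat (e - int i))) (nat (e - int i)) else 0) i)"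

lemma coeff_hcomp: "coeff (coeff (hcomp e f) i) j = (if int (i + j) = e then coeff (coeff f i) j else 0)"
proof -
  have "coeff (hcomp e f) i = (if i \<le> degree f \<and> e \<ge> int i then
      monom (coeff (coeff f i) (nat (e - int i))) (nat (e - int i)) else 0)"
    unfolding hcomp_def by (simp add: coeff_sum)
  also have "coeff \<dots> j = (if int (i + j) = e then coeff (coeff f i) j else 0)"
    by (auto simp: coeff_monom coeff_eq_0 nat_eq_iff not_le)
  finally show ?thesis .
qed

lemma hcomp_in_forms: "hcomp e f \<in> forms e"
  by (auto simp: forms_def coeff_hcomp)

lemma hcomp_form: "f \<in> forms a \<Longrightarrow> hcomp e f = (if e = a then f else 0)"
  unfolding forms_def by (intro poly_eqI) (auto simp: coeff_hcomp)

lemma hcomp_same: "f \<in> forms e \<Longrightarrow> hcomp e f = f"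
  by (simp add: hcomp_form)

lemma hcomp_add: "hcomp e (f + g) = hcomp e f + hcomp e g"
  by (intro poly_eqI) (simp add: coeff_hcomp)

lemma hcomp_zero [simp]: "hcomp e 0 = 0"
  by (intro poly_eqI) (simp add: coeff_hcomp)

lemma hcomp_sum: "hcomp e (sum f A) = (\<Sum>a\<in>A. hcomp e (f a))"
  by (induction A rule: infinite_finite_induct) (auto simp: hcomp_add)

lemma hcomp_diff: "hcomp e (f - g) = hcomp e f - hcomp e g"
  by (intro poly_eqI) (simp add: coeff_hcomp)

lemma sum_hcomp: "\<exists>A. finite A \<and> f = (\<Sum>k\<in>A. hcomp k f)"
proof (intro exI conjI)
  let ?S = "(\<lambda>(i, j). int (i + j)) ` (SIGMA i:{..degree f}. {..degree (coeff f i)})"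
  show "finite ?S" by auto
  show "f = (\<Sum>k\<in>?S. hcomp k f)"
  proof (intro poly_eqI)
    fix i j
    have "coeff (coeff (\<Sum>k\<in>?S. hcomp k f) i) j = (\<Sum>k\<in>?S. if k = int (i + j) then coeff (coeff f i) j else 0)"
      by (simp add: coeff_sum coeff_hcomp eq_commute)
    also have "\<dots> = (if int (i + j) \<in> ?S then coeff (coeff f i) j else 0)"
      using \<open>finite ?S\<close> by (simp add: sum.delta)
    also have "\<dots> = coeff (coeff f i) j"
    proof (cases "coeff (coeff f i) j = 0")
      case False
      then have "(i, j) \<in> (SIGMA i:{..degree f}. {..degree (coeff f i)})"
        by (auto intro!: le_degree)
      then have "int (i + j) \<in> ?S" by force
      then show ?thesis by simp
    qed simp
    finally show "coeff (coeff f i) j = coeff (coeff (\<Sum>k\<in>?S. hcomp k f) i) j" by simp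
  qed
qed

lemma hcomp_mult_form:
  assumes "g \<in> forms a"
  shows "hcomp e (f * g) = hcomp (e - a) f * g"
proof -
  obtain A where A: "finite A" "f = (\<Sum>k\<in>A. hcomp k f)" using sum_hcomp by blast
  have g: "hcomp k f * g \<in> forms (k + a)" for k
    by (intro forms_mult hcomp_in_forms assms)
  have "hcomp e (f * g) = hcomp e ((\<Sum>k\<in>A. hcomp k f) * g)" by (simp flip: A(2))
  also have "\<dots> = (\<Sum>k\<in>A. hcomp e (hcomp k f * g))"
    by (simp add: sum_distrib_right hcomp_sum)
  also have "\<dots> = (\<Sum>k\<in>A. hcomp (e - a) (hcomp k f) * g)"
    by (intro sum.cong refl) (auto simp: hcomp_form[OF g] hcomp_form[OF hcomp_in_forms])
  also have "\<dots> = hcomp (e - a) (\<Sum>k\<in>A. hcomp k f) * g"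
    by (simp add: sum_distrib_right hcomp_sum)
  finally show ?thesis by (simp flip: A(2))
qed

lemma hcomp_form_mult: "g \<in> forms a \<Longrightarrow> hcomp e (g * f) = g * hcomp (e - a) f"
  using hcomp_mult_form[of g a e f] by (simp add: mult.commute)

text \<open>
  Taking components of the coordinates turns any combination of homogeneous elements, in
  particular any relation, into a homogeneous one.
\<close>

lemma hcomp_combination:
  assumes "\<And>k. k < n \<Longrightarrow> g k \<in> forms (a k)"
  shows "hcomp e (\<Sum>k<n. v k * g k) = (\<Sum>k<n. hcomp (e - a k) (v k) * g k)"
  unfolding hcomp_sum using assms by (intro sum.cong refl hcomp_mult_form) auto

text \<open>
  The component of \<open>u\<close> of degree \<open>b - a\<close> has the same product with \<open>p\<close> as \<open>u\<close> itself, and \<open>p\<close> can be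
  cancelled.
\<close>

lemma form_factor:
  fixes p :: "'a::field poly poly"
  assumes "p \<in> forms a" "p \<noteq> 0" "p * u \<in> forms b"
  shows "u \<in> forms (b - a)"
proof -
  have "p * hcomp (b - a) u = p * u"
    using hcomp_form_mult[OF assms(1), of b u] hcomp_same[OF assms(3)] by metis
  then have "hcomp (b - a) u = u" using assms(2) by (metis mult_left_cancel)
  then show ?thesis by (metis hcomp_in_forms)
qed

section \<open>The maximal ideal\<close>

abbreviation const_coeff :: "'a::zero poly poly \<Rightarrow> 'a" where
  "const_coeff f \<equiv> coeff (coeff f 0) 0"

lemma const_coeff_forms_nonzero: "f \<in> forms e \<Longrightarrow> e \<noteq> 0 \<Longrightarrow> const_coeff f = 0"
  unfolding forms_def by force

lemma forms_0_const: "f \<in> forms 0 \<Longrightarrow> f = [:[:const_coeff f:]:]"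
  unfolding forms_def by (intro poly_eqI) (fastforce simp: coeff_pCons split: nat.splits)

lemma const_coeff_hcomp: "const_coeff (hcomp e f) = (if e = 0 then const_coeff f else 0)"
  by (simp add: coeff_hcomp)

lemma const_coeff_mult: "const_coeff (f * g) = const_coeff f * const_coeff g"
  by (simp add: coeff_mult_0)

lemma const_coeff_var: "const_coeff var_x = 0" "const_coeff var_y = 0"
  by (simp_all add: var_x_def var_y_def)

lemma const_coeff_zero_decomp:
  assumes "const_coeff f = 0"
  shows "\<exists>u v. f = var_x * u + var_y * v"
proof -
  obtain c q where f: "f = pCons c q" by (cases f)
  obtain b r where c: "c = pCons b r" by (cases c)
  have "b = 0" using assms f c by simp
  then have "f = var_x * [:r:] + var_y * q"
    unfolding var_x_mult var_y_mult by (simp add: f c)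
  then show ?thesis by blast
qed

lemma const_coeff_zero_decomp_form:
  assumes "f \<in> forms e" "const_coeff f = 0"
  shows "\<exists>u\<in>forms (e - 1). \<exists>v\<in>forms (e - 1). f = var_x * u + var_y * v"
proof -
  obtain u v where uv: "f = var_x * u + var_y * v" using const_coeff_zero_decomp assms by blast
  have "f = hcomp e f" using assms by (simp add: hcomp_same)
  also have "\<dots> = var_x * hcomp (e - 1) u + var_y * hcomp (e - 1) v"
    by (simp add: uv hcomp_add hcomp_form_mult[OF var_x_forms] hcomp_form_mult[OF var_y_forms])
  finally show ?thesis using hcomp_in_forms by blast
qed

lemma ideal_times_mult:
  "module.subspace (*) A \<Longrightarrow> f \<in> A \<Longrightarrow> g * f \<in> A"
  using module.subspace_scale[OF module_times] by blast

lemma maximal_ideal_iff: "f \<in> ideal_gen {var_x, var_y} \<longleftrightarrow> const_coeff f = 0"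
proof
  assume "f \<in> ideal_gen {var_x, var_y}"
  moreover have "module.subspace (*) {f :: 'a poly poly. const_coeff f = 0}"
    by (intro module.subspaceI[OF module_times]) (auto simp: const_coeff_mult)
  ultimately show "const_coeff f = 0"
    using module.span_minimal[OF module_times, of "{var_x, var_y}" "{f. const_coeff f = 0}"]
    by (auto simp: const_coeff_var)
next
  assume "const_coeff f = 0"
  then obtain u v where "f = u * var_x + v * var_y"
    using const_coeff_zero_decomp by (metis mult.commute)
  then show "f \<in> ideal_gen {var_x, var_y}"
    by (simp only:) (intro module.span_add[OF module_times] module.span_scale[OF module_times]
        module.span_base[OF module_times]; simp)
qed

text \<open>
  Exactness of the Koszul complex of \<open>x, y\<close> in the middle, the only input from commutative algebra
  in the computation of the regularity.
\<close>

lemma var_regular: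
  fixes u v :: "'a::field poly poly"
  assumes "var_x * u + var_y * v = 0"
  shows "\<exists>z. u = var_y * z \<and> v = - (var_x * z)"
proof -
  have *: "smult [:0, 1:] u + pCons 0 v = 0" using assms by (simp add: var_x_mult var_y_mult)
  obtain c z where u: "u = pCons c z" by (cases u)
  have "coeff (smult [:0, 1:] u + pCons 0 v) 0 = 0" using * by simp
  then have "c = 0" by (simp add: u)
  then have u': "u = var_y * z" by (simp add: u var_y_mult)
  then have "var_y * (var_x * z + v) = 0" using assms by (simp add: algebra_simps)
  then have "var_x * z + v = 0" by (simp add: var_y_def)
  then show ?thesis using u' by (metis add.commute eq_neg_iff_add_eq_0)
qed

lemma var_nonzero: "var_x \<noteq> (0::'a::field poly poly)" "var_y \<noteq> (0::'a::field poly poly)"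
  by (simp_all add: var_x_def var_y_def)

section \<open>Presentations of a homogeneous ideal\<close>

text \<open>
  The first two steps of a minimal resolution of \<open>J\<close>: generators \<open>g\<close> in degrees \<open>a\<close> and relations
  \<open>\<psi>\<close> in degrees \<open>b\<close>. Minimality is stated through the constant coefficients of arbitrary relations
  among the generators and among the columns of \<open>\<psi>\<close>. That the latter relations are in fact zero,
  so that the resolution stops here, is derived below.
\<close>

definition presents ::
  "'a::field poly poly set \<Rightarrow> nat \<Rightarrow> (nat \<Rightarrow> int) \<Rightarrow> (nat \<Rightarrow> 'a poly poly) \<Rightarrow>
   nat \<Rightarrow> (nat \<Rightarrow> int) \<Rightarrow> (nat \<Rightarrow> nat \<Rightarrow> 'a poly poly) \<Rightarrow> bool" where
  "presents J n a g m b \<psi> \<longleftrightarrow>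
     (\<forall>k<n. g k \<in> J \<inter> forms (a k)) \<and>
     (\<forall>e. \<forall>h\<in>J \<inter> forms e. \<exists>v. h = (\<Sum>k<n. v k * g k)) \<and>
     (\<forall>k<m. \<forall>l<n. \<psi> k l \<in> forms (b k - a l)) \<and>
     (\<forall>v. (\<Sum>k<n. v k * g k) = 0 \<longleftrightarrow> (\<exists>w. \<forall>l<n. v l = (\<Sum>k<m. w k * \<psi> k l))) \<and>
     (\<forall>v. (\<Sum>k<n. v k * g k) = 0 \<longrightarrow> (\<forall>k<n. const_coeff (v k) = 0)) \<and>
     (\<forall>v. (\<forall>l<n. (\<Sum>k<m. v k * \<psi> k l) = 0) \<longrightarrow> (\<forall>k<m. const_coeff (v k) = 0))"

lemma presentsD:
  assumes "presents J n a g m b \<psi>"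
  shows "\<And>k. k < n \<Longrightarrow> g k \<in> J" "\<And>k. k < n \<Longrightarrow> g k \<in> forms (a k)"
    "\<And>h e. h \<in> J \<Longrightarrow> h \<in> forms e \<Longrightarrow> \<exists>v. h = (\<Sum>k<n. v k * g k)"
    "\<And>k l. k < m \<Longrightarrow> l < n \<Longrightarrow> \<psi> k l \<in> forms (b k - a l)"
    "\<And>v. (\<Sum>k<n. v k * g k) = 0 \<Longrightarrow> \<exists>w. \<forall>l<n. v l = (\<Sum>k<m. w k * \<psi> k l)"
    "\<And>v w. (\<And>l. l < n \<Longrightarrow> v l = (\<Sum>k<m. w k * \<psi> k l)) \<Longrightarrow> (\<Sum>k<n. v k * g k) = 0"
    "\<And>v k. (\<Sum>k<n. v k * g k) = 0 \<Longrightarrow> k < n \<Longrightarrow> const_coeff (v k) = 0"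
    "\<And>v k. (\<And>l. l < n \<Longrightarrow> (\<Sum>k<m. v k * \<psi> k l) = 0) \<Longrightarrow> k < m \<Longrightarrow> const_coeff (v k) = 0"
  using assms unfolding presents_def by blast+

lemma sum_linear:
  fixes g :: "nat \<Rightarrow> 'a::comm_ring_1"
  shows "(\<Sum>k<n. (c * u k + d * v k) * g k) = c * (\<Sum>k<n. u k * g k) + d * (\<Sum>k<n. v k * g k)"
  by (simp add: distrib_right sum.distrib sum_distrib_left mult.assoc)

lemma homogeneous_coordinates:
  assumes "\<And>k. k < n \<Longrightarrow> g k \<in> forms (a k)" "h \<in> forms e" "h = (\<Sum>k<n. v k * g k)"
  shows "\<exists>u. (\<forall>k<n. u k \<in> forms (e - a k)) \<and> h = (\<Sum>k<n. u k * g k)"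
proof (intro exI conjI allI impI)
  show "hcomp (e - a k) (v k) \<in> forms (e - a k)" for k
    by (rule hcomp_in_forms)
  show "h = (\<Sum>k<n. hcomp (e - a k) (v k) * g k)"
    using hcomp_combination[of n g a e v] assms hcomp_same[OF assms(2)] by simp
qed

lemma coeff_coeff_var_combination:
  assumes "\<And>i j. i + j < N \<Longrightarrow> coeff (coeff u i) j = 0" "\<And>i j. i + j < N \<Longrightarrow> coeff (coeff v i) j = 0"
    and "i + j < Suc N"
  shows "coeff (coeff (var_x * u + var_y * v) i) j = 0"
  using assms(3) by (cases i; cases j) (auto simp: var_x_mult var_y_mult coeff_pCons assms)

text \<open>
  If \<open>w = x u + y v\<close> is a relation among the columns of \<open>\<psi>\<close>, then
  regularity of the pair \<open>x, y\<close>, applied to the images of \<open>u\<close> and \<open>v\<close> and then once more to an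
  element of the torsion free ideal \<open>J\<close>, shows that \<open>u\<close> and \<open>v\<close> can be chosen to be relations. So
  the module of these relations is \<open>(x,y)\<close> times itself.
\<close>

lemma second_syzygies_divide:
  assumes P: "presents J n a g m b \<psi>"
    and w: "\<And>l. l < n \<Longrightarrow> (\<Sum>k<m. w k * \<psi> k l) = 0"
  shows "\<exists>u v. (\<forall>k<m. w k = var_x * u k + var_y * v k) \<and>
     (\<forall>l<n. (\<Sum>k<m. u k * \<psi> k l) = 0) \<and> (\<forall>l<n. (\<Sum>k<m. v k * \<psi> k l) = 0)"
proof -
  have "\<exists>u v. k < m \<longrightarrow> w k = var_x * u + var_y * v" for k
    using const_coeff_zero_decomp[of "w k"] presentsD(8)[OF P, of w k] w by blast
  then obtain u v where uv: "\<And>k. k < m \<Longrightarrow> w k = var_x * u k + var_y * v k" by metis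
  let ?D = "\<lambda>w l. \<Sum>k<m. w k * \<psi> k l"
  have "\<exists>z. l < n \<longrightarrow> ?D u l = var_y * z \<and> ?D v l = - (var_x * z)" for l
  proof (cases "l < n")
    case True
    have "var_x * ?D u l + var_y * ?D v l = ?D (\<lambda>k. var_x * u k + var_y * v k) l"
      by (rule sum_linear[symmetric])
    also have "\<dots> = ?D w l" using uv by simp
    finally have "var_x * ?D u l + var_y * ?D v l = 0" using w True by simp
    then show ?thesis using var_regular by blast
  qed auto
  then have "\<exists>z. \<forall>l. l < n \<longrightarrow> ?D u l = var_y * z l \<and> ?D v l = - (var_x * z l)"
    by (intro choice allI)
  then obtain z where z: "\<And>l. l < n \<Longrightarrow> ?D u l = var_y * z l \<and> ?D v l = - (var_x * z l)"
    by blast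
  have "(\<Sum>l<n. ?D u l * g l) = 0" by (rule presentsD(6)[OF P, where w = u]) simp
  then have "var_y * (\<Sum>l<n. z l * g l) = 0"
    using z by (simp add: sum_distrib_left mult.assoc)
  then have "(\<Sum>l<n. z l * g l) = 0" by (simp add: var_nonzero)
  then obtain q where q: "\<And>l. l < n \<Longrightarrow> z l = ?D q l" using presentsD(5)[OF P, of z] by blast
  have 1: "?D (\<lambda>k. u k - var_y * q k) l = 0" if "l < n" for l
    using z[OF that] q[OF that] by (simp add: left_diff_distrib sum_subtractf sum_distrib_left mult.assoc)
  have 2: "?D (\<lambda>k. v k + var_x * q k) l = 0" if "l < n" for l
    using z[OF that] q[OF that] by (simp add: distrib_right sum.distrib sum_distrib_left mult.assoc)
  have 3: "w k = var_x * (u k - var_y * q k) + var_y * (v k + var_x * q k)" if "k < m" for k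
    using uv[OF that] by (simp add: algebra_simps)
  show ?thesis
    by (rule exI[of _ "\<lambda>k. u k - var_y * q k"], rule exI[of _ "\<lambda>k. v k + var_x * q k"])
      (intro conjI allI impI 1 2 3)
qed

text \<open>
  By the previous lemma every coordinate of a second syzygy lies in all powers of \<open>(x,y)\<close>.
\<close>

lemma second_syzygies_vanish:
  assumes P: "presents J n a g m b \<psi>"
    and w: "\<And>l. l < n \<Longrightarrow> (\<Sum>k<m. w k * \<psi> k l) = 0" and "k < m"
  shows "w k = 0"
proof -
  have "coeff (coeff (w k) i) j = 0" if "i + j < N" for i j N
    using w \<open>k < m\<close> that
  proof (induction N arbitrary: w k i j)
    case (Suc N)
    obtain u v where uv: "\<forall>k<m. w k = var_x * u k + var_y * v k"
     "\<forall>l<n. (\<Sum>k<m. u k * \<psi> k l) = 0" "\<forall>l<n. (\<Sum>k<m. v k * \<psi> k l) = 0"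
      using second_syzygies_divide[OF P, of w] Suc.prems(1) by blast
    have "coeff (coeff (u k) i) j = 0" "coeff (coeff (v k) i) j = 0" if "i + j < N" for i j
      using Suc.IH[of u k i j] Suc.IH[of v k i j] uv Suc.prems(2) that by blast+
    then show ?case
      using uv(1) Suc.prems(2,3) coeff_coeff_var_combination[of N "u k" "v k" i j] by simp
  qed simp
  then show ?thesis by (intro poly_eqI) (metis coeff_0 less_add_one)
qed

text \<open>
  After writing \<open>v = x u + y w\<close>, regularity of \<open>x, y\<close> produces a form \<open>h\<close> of degree \<open>e - 2\<close> with
  \<open>y h\<close> and \<open>- x h\<close> the images of \<open>u\<close> and \<open>w\<close>. Since \<open>e - 2 \<ge> e\<^sub>0\<close>, it lies in \<open>J\<close>, and its
  coordinates correct \<open>u\<close> and \<open>w\<close> to syzygies. So syzygies of degree at least \<open>e\<^sub>0 + 2\<close> come from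
  lower degree.
\<close>

lemma first_syzygies_divide:
  fixes g :: "nat \<Rightarrow> 'a::field poly poly"
  assumes g: "\<And>k. k < n \<Longrightarrow> g k \<in> forms (a k)"
    and gen: "\<And>h e. h \<in> J \<Longrightarrow> h \<in> forms e \<Longrightarrow> \<exists>v. h = (\<Sum>k<n. v k * g k)"
    and J: "\<And>e. e \<ge> e0 \<Longrightarrow> forms e \<subseteq> J"
    and e: "e \<ge> e0 + 2"
    and v: "\<And>k. k < n \<Longrightarrow> v k \<in> forms (e - a k)" "\<And>k. k < n \<Longrightarrow> const_coeff (v k) = 0"
      "(\<Sum>k<n. v k * g k) = 0"
  obtains p q where "\<And>k. k < n \<Longrightarrow> v k = var_x * p k + var_y * q k"
    "\<And>k. k < n \<Longrightarrow> p k \<in> forms (e - 1 - a k)" "\<And>k. k < n \<Longrightarrow> q k \<in> forms (e - 1 - a k)"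
    "(\<Sum>k<n. p k * g k) = 0" "(\<Sum>k<n. q k * g k) = 0"
proof -
  have "\<exists>u w. k < n \<longrightarrow> v k = var_x * u + var_y * w \<and>
      u \<in> forms (e - 1 - a k) \<and> w \<in> forms (e - 1 - a k)" for k
    using const_coeff_zero_decomp_form[of "v k" "e - a k"] v(1,2)[of k]
    by (auto simp: algebra_simps)
  then obtain u w where uw: "\<And>k. k < n \<Longrightarrow> v k = var_x * u k + var_y * w k"
    "\<And>k. k < n \<Longrightarrow> u k \<in> forms (e - 1 - a k)" "\<And>k. k < n \<Longrightarrow> w k \<in> forms (e - 1 - a k)"
    by metis
  let ?E = "\<lambda>v. \<Sum>k<n. v k * g k"
  have "var_x * ?E u + var_y * ?E w = ?E (\<lambda>k. var_x * u k + var_y * w k)"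
    by (rule sum_linear[symmetric])
  also have "\<dots> = ?E v" using uw by simp
  finally have "var_x * ?E u + var_y * ?E w = 0" using v by simp
  then obtain h where h: "?E u = var_y * h" "?E w = - (var_x * h)" using var_regular by blast
  have "?E u \<in> forms (e - 1)"
  proof (intro forms_sum)
    fix k assume "k \<in> {..<n}"
    then show "u k * g k \<in> forms (e - 1)"
      using forms_mult[OF uw(2) g, of k k] by simp
  qed
  then have hf: "h \<in> forms (e - 2)"
    using form_factor[OF var_y_forms var_nonzero(2), of h "e - 1"] h by simp
  then have "h \<in> J" using J[of "e - 2"] e by auto
  then obtain z' where z': "h = ?E z'" using gen hf by blast
  obtain z where z: "\<And>k. k < n \<Longrightarrow> z k \<in> forms (e - 2 - a k)" "h = ?E z"
    using homogeneous_coordinates[OF g hf z'] by blast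
  show ?thesis
  proof
    show "v k = var_x * (u k - var_y * z k) + var_y * (w k + var_x * z k)" if "k < n" for k
      using uw(1)[OF that] by (simp add: algebra_simps)
    show "u k - var_y * z k \<in> forms (e - 1 - a k)" if "k < n" for k
      using forms_diff[OF uw(2)[OF that], of "var_y * z k"] forms_mult[OF var_y_forms z(1)[OF that]]
      by (simp add: algebra_simps)
    show "w k + var_x * z k \<in> forms (e - 1 - a k)" if "k < n" for k
      using forms_add[OF uw(3)[OF that], of "var_x * z k"] forms_mult[OF var_x_forms z(1)[OF that]]
      by (simp add: algebra_simps)
    show "?E (\<lambda>k. u k - var_y * z k) = 0"
      using h z(2) by (simp add: left_diff_distrib sum_subtractf sum_distrib_left mult.assoc)
    show "?E (\<lambda>k. w k + var_x * z k) = 0"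
      using h z(2) by (simp add: distrib_right sum.distrib sum_distrib_left mult.assoc)
  qed
qed

section \<open>Regularity from the degrees of a presentation\<close>

lemma forms_step:
  fixes J :: "'a::field poly poly set"
  assumes J: "module.subspace (*) J" and "forms e \<subseteq> J" "e \<ge> 0"
  shows "forms (e + 1) \<subseteq> J"
proof
  fix f :: "'a poly poly" assume f: "f \<in> forms (e + 1)"
  then have "const_coeff f = 0" using assms(3) by (intro const_coeff_forms_nonzero) auto
  then obtain u v where "u \<in> forms e" "v \<in> forms e" "f = var_x * u + var_y * v"
    using const_coeff_zero_decomp_form[OF f] by auto
  then show "f \<in> J"
    using assms(2) by (auto intro!: module.subspace_add[OF module_times J] ideal_times_mult[OF J])
qed

lemma forms_upward:
  fixes J :: "'a::field poly poly set"
  assumes J: "module.subspace (*) J" and "forms e0 \<subseteq> J" "e0 \<ge> 0" "e \<ge> e0"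
  shows "forms e \<subseteq> J"
  using assms(4)
proof (induction e rule: int_ge_induct)
  case (step i)
  then show ?case using forms_step[OF J, of i] assms(3) by simp
qed (use assms in simp)

text \<open>
  A generator of larger degree would be a combination of \<open>x\<close> and \<open>y\<close> with coefficients in \<open>J\<close>, and this
  gives a relation in which it has constant coefficient \<open>1\<close>.
\<close>

lemma generator_degree_bound:
  assumes P: "presents J n a g m b \<psi>"
    and J: "\<And>e. e \<ge> e0 \<Longrightarrow> forms e \<subseteq> J" "e0 \<ge> 0" and k: "k < n"
  shows "a k \<le> e0"
proof (rule ccontr)
  assume "\<not> a k \<le> e0"
  then have "const_coeff (g k) = 0"
    using const_coeff_forms_nonzero[OF presentsD(2)[OF P k]] J(2) by auto
  then obtain p q where pq: "p \<in> forms (a k - 1)" "q \<in> forms (a k - 1)" "g k = var_x * p + var_y * q"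
    using const_coeff_zero_decomp_form[OF presentsD(2)[OF P k]] by blast
  moreover have "forms (a k - 1) \<subseteq> J" using J(1) \<open>\<not> a k \<le> e0\<close> by simp
  ultimately obtain u v where uv: "p = (\<Sum>k<n. u k * g k)" "q = (\<Sum>k<n. v k * g k)"
    using presentsD(3)[OF P] by (meson subsetD)
  let ?w = "\<lambda>l. (if l = k then 1 else 0) - (var_x * u l + var_y * v l)"
  have "(\<Sum>l<n. ?w l * g l) = (\<Sum>l<n. (if l = k then g l else 0)) - (var_x * p + var_y * q)"
    unfolding uv left_diff_distrib sum_subtractf sum_linear
    by (intro arg_cong2[of _ _ _ _ "(-)"] sum.cong) auto
  also have "\<dots> = 0" using k pq(3) by (simp add: sum.delta)
  finally have "const_coeff (?w k) = 0" using presentsD(7)[OF P _ k, of ?w] by simp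
  then show False by (simp add: const_coeff_mult const_coeff_var)
qed

text \<open>
  A relation of larger degree would be a combination of syzygies of lower degree with coefficients
  \<open>x\<close> and \<open>y\<close>, and this gives a second syzygy in which it has constant coefficient \<open>1\<close>.
\<close>

lemma relation_degree_bound:
  assumes P: "presents J n a g m b \<psi>"
    and J: "\<And>e. e \<ge> e0 \<Longrightarrow> forms e \<subseteq> J" "e0 \<ge> 0" and k: "k < m"
  shows "b k - 1 \<le> e0"
proof (rule ccontr)
  assume "\<not> b k - 1 \<le> e0"
  then have e: "b k \<ge> e0 + 2" by simp
  have rel: "(\<Sum>l<n. \<psi> k l * g l) = 0"
  proof (rule presentsD(6)[OF P, where w = "\<lambda>i. if i = k then 1 else 0"])
    show "\<psi> k l = (\<Sum>i<m. (if i = k then 1 else 0) * \<psi> i l)" if "l < n" for l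
      using k by (simp add: if_distrib[of "\<lambda>c. c * _"] sum.delta cong: if_cong)
  qed
  obtain p q where pq: "\<And>l. l < n \<Longrightarrow> \<psi> k l = var_x * p l + var_y * q l"
    "(\<Sum>l<n. p l * g l) = 0" "(\<Sum>l<n. q l * g l) = 0"
    by (rule first_syzygies_divide[OF presentsD(2)[OF P] presentsD(3)[OF P] J(1) e,
          where v = "\<psi> k"]) (use presentsD(4)[OF P k] presentsD(7)[OF P rel] rel in auto)
  obtain p' q' where p': "\<And>l. l < n \<Longrightarrow> p l = (\<Sum>i<m. p' i * \<psi> i l)"
    and q': "\<And>l. l < n \<Longrightarrow> q l = (\<Sum>i<m. q' i * \<psi> i l)"
    using presentsD(5)[OF P pq(2)] presentsD(5)[OF P pq(3)] by blast
  let ?w = "\<lambda>i. (if i = k then 1 else 0) - (var_x * p' i + var_y * q' i)"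
  have "(\<Sum>i<m. ?w i * \<psi> i l) = 0" if "l < n" for l
  proof -
    have "(\<Sum>i<m. ?w i * \<psi> i l) = (\<Sum>i<m. (if i = k then \<psi> i l else 0)) - (var_x * p l + var_y * q l)"
      unfolding p'[OF that] q'[OF that] left_diff_distrib sum_subtractf sum_linear
      by (intro arg_cong2[of _ _ _ _ "(-)"] sum.cong) auto
    then show ?thesis using k pq(1)[OF that] by (simp add: sum.delta)
  qed
  then have "const_coeff (?w k) = 0" using presentsD(8)[OF P _ k, of ?w] by simp
  then show False by (simp add: const_coeff_mult const_coeff_var)
qed

text \<open>
  A form \<open>h\<close> of degree \<open>e\<^sub>0 - 1\<close> outside \<open>J\<close> is a socle element modulo \<open>J\<close>, and the syzygy expressing
  \<open>x (y h) = y (x h)\<close> has degree \<open>e\<^sub>0 + 1\<close>. If no relation had this degree, the syzygy would have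
  coefficients in \<open>(x,y)\<close>, and dividing it by \<open>x\<close> and \<open>y\<close> would express \<open>h\<close> through the generators.
\<close>

lemma relation_degree_attained:
  fixes g :: "nat \<Rightarrow> 'a::field poly poly"
  assumes P: "presents J n a g m b \<psi>" and J: "module.subspace (*) J"
    and e0: "forms e0 \<subseteq> J" "\<not> forms (e0 - 1) \<subseteq> J" "e0 \<ge> 0"
  shows "\<exists>k<m. b k - 1 = e0"
proof (rule ccontr)
  assume neg: "\<not> (\<exists>k<m. b k - 1 = e0)"
  let ?E = "\<lambda>v. \<Sum>k<n. v k * g k"
  let ?D = "\<lambda>w l. \<Sum>k<m. w k * \<psi> k l"
  obtain h where h: "h \<in> forms (e0 - 1)" "h \<notin> J" using e0(2) by blast
  have f: "var_y * h \<in> forms e0" "var_x * h \<in> forms e0"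
    using forms_mult[OF var_y_forms h(1)] forms_mult[OF var_x_forms h(1)] by simp_all
  obtain u' v' where uv': "var_y * h = ?E u'" "var_x * h = ?E v'"
    using presentsD(3)[OF P] f e0(1) by (meson subsetD)
  obtain u where u: "\<And>k. k < n \<Longrightarrow> u k \<in> forms (e0 - a k)" "var_y * h = ?E u"
    using homogeneous_coordinates[OF presentsD(2)[OF P] f(1) uv'(1)] by blast
  obtain v where v: "\<And>k. k < n \<Longrightarrow> v k \<in> forms (e0 - a k)" "var_x * h = ?E v"
    using homogeneous_coordinates[OF presentsD(2)[OF P] f(2) uv'(2)] by blast
  define s where "s l = var_x * u l + (- var_y) * v l" for l
  have "?E s = 0"
    unfolding s_def sum_linear u(2)[symmetric] v(2)[symmetric] by (simp add: algebra_simps)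
  then obtain w where w: "\<And>l. l < n \<Longrightarrow> s l = ?D w l" using presentsD(5)[OF P] by blast
  have s: "s l \<in> forms (e0 + 1 - a l)" if "l < n" for l
    unfolding s_def using forms_diff[OF forms_mult[OF var_x_forms u(1)[OF that]] forms_mult[OF var_y_forms v(1)[OF that]]]
    by (simp add: algebra_simps)
  \<comment> \<open>The component of the right degree, so that its constant coefficients can be controlled.\<close>
  define w' where "w' k = hcomp (e0 + 1 - b k) (w k)" for k
  have w': "s l = ?D w' l" if "l < n" for l
  proof -
    have "s l = hcomp (e0 + 1 - a l) (?D w l)" using hcomp_same[OF s[OF that]] w[OF that] by simp
    also have "\<dots> = (\<Sum>k<m. hcomp (e0 + 1 - a l - (b k - a l)) (w k) * \<psi> k l)"
      by (rule hcomp_combination) (use presentsD(4)[OF P] that in auto)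
    finally show ?thesis by (simp add: w'_def algebra_simps)
  qed
  have "const_coeff (w' k) = 0" if "k < m" for k
    using neg that by (auto simp: w'_def const_coeff_hcomp)
  then have "\<exists>p q. k < m \<longrightarrow> w' k = var_x * p + var_y * q" for k
    using const_coeff_zero_decomp by blast
  then obtain p q where pq: "\<And>k. k < m \<Longrightarrow> w' k = var_x * p k + var_y * q k" by metis
  have "\<exists>z. l < n \<longrightarrow> u l - ?D p l = var_y * z" for l
  proof (cases "l < n")
    case True
    have "var_x * (u l - ?D p l) + var_y * (- v l - ?D q l)
        = s l - (var_x * ?D p l + var_y * ?D q l)"
      by (simp add: s_def algebra_simps)
    also have "var_x * ?D p l + var_y * ?D q l = ?D w' l"
      using pq by (simp add: sum_linear[symmetric])
    finally have "var_x * (u l - ?D p l) + var_y * (- v l - ?D q l) = 0" using w'[OF True] by simp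
    then show ?thesis using var_regular by blast
  qed auto
  then have "\<exists>z. \<forall>l. l < n \<longrightarrow> u l - ?D p l = var_y * z l"
    by (intro choice allI)
  then obtain z where z: "\<And>l. l < n \<Longrightarrow> u l - ?D p l = var_y * z l"
    by blast
  have "?E (\<lambda>l. ?D p l) = 0" by (rule presentsD(6)[OF P, where w = p]) simp
  then have "var_y * h = ?E (\<lambda>l. u l - ?D p l)"
    using u(2) by (simp add: left_diff_distrib sum_subtractf)
  also have "\<dots> = var_y * ?E z"
    using z by (simp add: sum_distrib_left mult.assoc)
  finally have "h = ?E z" by (simp add: var_nonzero)
  also have "\<dots> \<in> J"
    using presentsD(1)[OF P] by (intro module.subspace_sum[OF module_times J] ideal_times_mult[OF J]) auto
  finally show False using h by simp
qed

section \<open>Existence of minimal presentations\<close>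

text \<open>
  Induction on the number of coordinate functions: one vector on which the new coordinate is
  nonzero reduces \<open>N\<close> to the kernel of that coordinate.
\<close>

lemma (in vector_space) finitely_spanned:
  assumes "finite C" "subspace N"
    and "\<And>c x y. c \<in> C \<Longrightarrow> c (x + y) = c x + c y" "\<And>c s x. c \<in> C \<Longrightarrow> c (scale s x) = s * c x"
    and "\<And>x. x \<in> N \<Longrightarrow> (\<And>c. c \<in> C \<Longrightarrow> c x = 0) \<Longrightarrow> x = 0"
  shows "\<exists>B. finite B \<and> B \<subseteq> N \<and> N \<subseteq> span B"
  using assms
proof (induction C arbitrary: N rule: finite_induct)
  case empty
  then have "N \<subseteq> span {}" by auto
  then show ?case by blast
next
  case (insert c C)
  have lin: "c (x + y) = c x + c y" "c (scale s x) = s * c x" for x y s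
    using insert.prems by auto
  have c0: "c 0 = 0" using lin(2)[of 0 0] by simp
  let ?N = "{x \<in> N. c x = 0}"
  have "subspace ?N"
    using insert.prems(1) by (auto simp: subspace_def lin c0)
  moreover have "x = 0" if "x \<in> ?N" "\<And>c. c \<in> C \<Longrightarrow> c x = 0" for x
    using that by (intro insert.prems(4)) auto
  ultimately have "\<exists>B. finite B \<and> B \<subseteq> ?N \<and> ?N \<subseteq> span B"
    using insert.prems(2,3) by (intro insert.IH) simp_all
  then obtain B where B: "finite B" "B \<subseteq> ?N" "?N \<subseteq> span B"
    by blast
  show ?case
  proof (cases "\<exists>b\<in>N. c b \<noteq> 0")
    case True
    then obtain b where b: "b \<in> N" "c b \<noteq> 0" by blast
    have "x \<in> span (insert b B)" if x: "x \<in> N" for x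
    proof -
      let ?s = "c x / c b"
      let ?y = "x + scale (- ?s) b"
      have "?y \<in> N" using x b insert.prems(1) by (intro subspace_add subspace_scale)
      moreover have "c ?y = 0" using b unfolding lin by simp
      ultimately have "?y \<in> span B" using B by blast
      then have "x - scale ?s b \<in> span B" by simp
      then show ?thesis unfolding span_breakdown_eq by blast
    qed
    then show ?thesis using B b by (intro exI[of _ "insert b B"]) auto
  next
    case False
    then show ?thesis using B by (intro exI[of _ B]) auto
  qed
qed

lemma forms_coordinates:
  assumes "f \<in> forms e" "\<And>i j. i \<le> nat e \<Longrightarrow> j \<le> nat e \<Longrightarrow> coeff (coeff f i) j = 0"
  shows "f = 0"
proof (intro poly_eqI)
  fix i j
  have "coeff (coeff f i) j = 0"
  proof (rule ccontr)
    assume *: "coeff (coeff f i) j \<noteq> 0"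
    then have "int (i + j) = e" using assms(1) by (auto simp: forms_def)
    then show False using * assms(2)[of i j] by auto
  qed
  then show "coeff (coeff f i) j = coeff (coeff 0 i) j" by simp
qed

lemma form_subspace_finitely_spanned:
  fixes N :: "'a::field poly poly set"
  assumes "form_subspace N" "N \<subseteq> forms e"
  shows "\<exists>B. finite B \<and> B \<subseteq> N \<and> N \<subseteq> vs.span B"
proof -
  let ?C = "(\<lambda>(i, j) (f :: 'a poly poly). coeff (coeff f i) j) ` ({..nat e} \<times> {..nat e})"
  show ?thesis
  proof (rule vs.finitely_spanned[of ?C])
    show "x = 0" if "x \<in> N" "\<And>c. c \<in> ?C \<Longrightarrow> c x = 0" for x
      using that assms(2) by (intro forms_coordinates[of x e]) auto
  qed (use assms(1) in \<open>auto simp: scalar_def\<close>)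
qed

lemma (in module) span_indexed:
  assumes "x \<in> span (g ` {..<n::nat})"
  shows "\<exists>v. x = (\<Sum>k<n. scale (v k) (g k))"
proof -
  let ?R = "{x. \<exists>v. x = (\<Sum>k<n. scale (v k) (g k))}"
  have "subspace ?R"
  proof (rule subspaceI)
    show "0 \<in> ?R" by (auto intro: exI[of _ "\<lambda>_. 0"])
    show "x + y \<in> ?R" if xy: "x \<in> ?R" "y \<in> ?R" for x y
    proof -
      obtain u v where "x = (\<Sum>k<n. scale (u k) (g k))" "y = (\<Sum>k<n. scale (v k) (g k))"
        using xy by blast
      then have "x + y = (\<Sum>k<n. scale (u k + v k) (g k))"
        by (simp add: scale_left_distrib sum.distrib)
      then show ?thesis by (intro CollectI exI[of _ "\<lambda>k. u k + v k"])
    qed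
    show "scale c x \<in> ?R" if x: "x \<in> ?R" for c x
    proof -
      obtain u where "x = (\<Sum>k<n. scale (u k) (g k))" using x by blast
      then have "scale c x = (\<Sum>k<n. scale (c * u k) (g k))"
        by (simp add: scale_sum_right)
      then show ?thesis by (intro CollectI exI[of _ "\<lambda>k. c * u k"])
    qed
  qed
  moreover have "g ` {..<n} \<subseteq> ?R"
  proof clarify
    fix k assume "k < n"
    then have "g k = (\<Sum>l<n. scale (if l = k then 1 else 0) (g l))"
      by (simp add: if_distrib[of "\<lambda>c. scale c _"] cong: if_cong)
    then show "\<exists>v. g k = (\<Sum>l<n. scale (v l) (g l))" by (intro exI[of _ "\<lambda>l. if l = k then 1 else 0"])
  qed
  ultimately show ?thesis using span_minimal[of "g ` {..<n}" ?R] assms by blast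
qed

text \<open>
  Above \<open>hi\<close> everything comes from degree \<open>hi\<close>, so only the finitely many degrees from \<open>lo\<close> to \<open>hi\<close>
  contribute generators.
\<close>

lemma (in module) finite_generation:
  fixes M :: "int \<Rightarrow> 'b set"
  assumes low: "\<And>e. e < lo \<Longrightarrow> M e \<subseteq> {0}"
    and mid: "\<And>e. e \<le> hi \<Longrightarrow> \<exists>G. finite G \<and> G \<subseteq> M e \<and> M e \<subseteq> span G"
    and high: "\<And>e. e > hi \<Longrightarrow> M e \<subseteq> span (M (e - 1))"
  shows "\<exists>G. finite G \<and> G \<subseteq> (\<Union>e. M e) \<and> (\<forall>e. M e \<subseteq> span G)"
proof -
  obtain G where G: "\<And>e. e \<le> hi \<Longrightarrow> finite (G e) \<and> G e \<subseteq> M e \<and> M e \<subseteq> span (G e)"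
    using mid by metis
  let ?G = "\<Union>e\<in>{lo..hi}. G e"
  have le: "M e \<subseteq> span ?G" if "e \<le> hi" for e
  proof (cases "e < lo")
    case True
    then show ?thesis using low[of e] span_zero[of ?G] by blast
  next
    case False
    then have "G e \<subseteq> ?G" using that by (intro UN_upper) auto
    then show ?thesis using G[OF that] span_mono by blast
  qed
  have gt: "M e \<subseteq> span ?G" if "e \<ge> hi" for e
    using that
  proof (induction e rule: int_ge_induct)
    case base
    then show ?case by (rule le) simp
  next
    case (step i)
    have "M (i + 1) \<subseteq> span (M i)" using high[of "i + 1"] step.hyps by simp
    also have "\<dots> \<subseteq> span ?G" using step.IH span_minimal by blast
    finally show ?case .
  qed
  have "finite ?G" "?G \<subseteq> (\<Union>e. M e)" using G by (auto, blast)
  then show ?thesis using le gt by (intro exI[of _ ?G]) (meson linear)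
qed

text \<open>
  A relation among homogeneous generators with a nonzero constant coefficient at \<open>g k\<close> may be
  replaced by its component of degree \<open>a k\<close>, and then it expresses \<open>g k\<close> through the other
  generators. So a homogeneous generating family of least possible length is minimal.
\<close>

lemma minimal_generators:
  fixes scale :: "'a::field poly poly \<Rightarrow> 'b::ab_group_add \<Rightarrow> 'b" and M :: "int \<Rightarrow> 'b set"
  assumes "module scale"
    and rel: "\<And>(n::nat) g a v e. (\<And>k. k < n \<Longrightarrow> g k \<in> M (a k)) \<Longrightarrow> (\<Sum>k<n. scale (v k) (g k)) = 0 \<Longrightarrow>
          (\<Sum>k<n. scale (hcomp (e - a k) (v k)) (g k)) = 0"
    and G: "finite G" "G \<subseteq> (\<Union>e. M e)" "\<And>e. M e \<subseteq> module.span scale G"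
  shows "\<exists>(n::nat) g a. (\<forall>k<n. g k \<in> M (a k)) \<and>
      (\<forall>e. M e \<subseteq> module.span scale (g ` {..<n})) \<and>
      (\<forall>v. (\<Sum>k<n. scale (v k) (g k)) = 0 \<longrightarrow> (\<forall>k<n. const_coeff (v k) = 0))"
proof -
  interpret module scale by fact
  define gens where "gens n g a \<longleftrightarrow> (\<forall>k<n. g k \<in> M (a k)) \<and> (\<forall>e. M e \<subseteq> span (g ` {..<n}))"
    for n :: nat and g a
  have "\<exists>n g a. gens n g a"
  proof -
    obtain h where h: "bij_betw h {0..<card G} G" using ex_bij_betw_nat_finite[OF G(1)] by blast
    then have im: "h ` {..<card G} = G" by (auto simp: bij_betw_def atLeast0LessThan)
    then have "\<forall>k. \<exists>e. k < card G \<longrightarrow> h k \<in> M e" using G(2) by blast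
    then obtain a where "\<forall>k<card G. h k \<in> M (a k)" by metis
    then have "gens (card G) h a" using im G(3) by (simp add: gens_def)
    then show ?thesis by blast
  qed
  then have ex: "\<exists>n. \<exists>g a. gens n g a" .
  define n where "n = (LEAST n. \<exists>g a. gens n g a)"
  obtain g a where ga: "gens n g a" using LeastI_ex[OF ex] unfolding n_def by blast
  have "const_coeff (v k) = 0" if v: "(\<Sum>k<n. scale (v k) (g k)) = 0" and k: "k < n" for v k
  proof (rule ccontr)
    assume c: "const_coeff (v k) \<noteq> 0"
    let ?c = "const_coeff (v k)"
    let ?v = "\<lambda>l. hcomp (a k - a l) (v l)"
    let ?S = "span (g ` ({..<n} - {k}))"
    have "(\<Sum>l<n. scale (?v l) (g l)) = 0"
      using rel[of n g a v "a k"] ga v by (simp add: gens_def)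
    then have "scale (?v k) (g k) + (\<Sum>l\<in>{..<n} - {k}. scale (?v l) (g l)) = 0"
      using k by (subst (asm) sum.remove[of _ k]) auto
    then have "scale (?v k) (g k) = - (\<Sum>l\<in>{..<n} - {k}. scale (?v l) (g l))"
      by (simp add: eq_neg_iff_add_eq_0)
    also have "\<dots> \<in> ?S"
      by (intro span_neg span_sum span_scale span_base imageI)
    finally have "scale ([:[:1 / ?c:]:] * ?v k) (g k) \<in> ?S"
      using span_scale by (metis scale_scale)
    moreover have "?v k = [:[:?c:]:]"
      using forms_0_const[OF hcomp_in_forms[of 0 "v k"]] by (simp add: const_coeff_hcomp)
    ultimately have "g k \<in> ?S" using c by (simp add: one_pCons[symmetric])
    then have "g ` {..<n} \<subseteq> ?S" by (auto intro: span_base)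
    then have S: "M e \<subseteq> ?S" for e
      using ga span_minimal[of "g ` {..<n}" ?S] unfolding gens_def by blast
    \<comment> \<open>The remaining generators, renumbered, contradict the choice of \<open>n\<close>.\<close>
    have "card {..<n - 1} = card ({..<n} - {k})" using k by simp
    then obtain \<sigma> where \<sigma>: "bij_betw \<sigma> {..<n - 1} ({..<n} - {k})"
      using finite_same_card_bij[of "{..<n - 1}" "{..<n} - {k}"] by auto
    then have im: "\<sigma> ` {..<n - 1} = {..<n} - {k}" by (simp add: bij_betw_def)
    then have "\<sigma> l < n" if "l < n - 1" for l using that by blast
    then have "gens (n - 1) (g \<circ> \<sigma>) (a \<circ> \<sigma>)"
      using ga S unfolding gens_def image_comp[symmetric] im by simp
    then have "n \<le> n - 1" unfolding n_def by (intro Least_le) blast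
    then show False using k by simp
  qed
  then show ?thesis using ga unfolding gens_def by blast
qed

lemma module_smult: "module (smult :: 'a::comm_ring_1 \<Rightarrow> _)"
  by unfold_locales (simp_all add: smult_add_right smult_add_left)

lemma vector_space_const_smult:
  "vector_space (\<lambda>(c::'a::field) (v :: 'a poly poly poly). smult [:[:c:]:] v)"
  by unfold_locales (simp_all add: smult_add_right smult_add_left[symmetric] one_pCons[symmetric])

lemma sum_hcomp_superset:
  "\<exists>A. finite A \<and> (\<forall>B. finite B \<longrightarrow> A \<subseteq> B \<longrightarrow> f = (\<Sum>k\<in>B. hcomp k f))"
proof -
  obtain A where A: "finite A" "f = (\<Sum>k\<in>A. hcomp k f)" using sum_hcomp by blast
  have "f = (\<Sum>k\<in>B. hcomp k f)" if "finite B" "A \<subseteq> B" for B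
  proof -
    have "hcomp k f = 0" if "k \<notin> A" for k
    proof -
      have "hcomp k f = (\<Sum>l\<in>A. hcomp k (hcomp l f))"
        using A(2) hcomp_sum by metis
      also have "\<dots> = 0" using that by (intro sum.neutral) (auto simp: hcomp_form[OF hcomp_in_forms])
      finally show ?thesis .
    qed
    then have "(\<Sum>k\<in>A. hcomp k f) = (\<Sum>k\<in>B. hcomp k f)"
      using that by (intro sum.mono_neutral_left) auto
    then show ?thesis using A(2) by simp
  qed
  then show ?thesis using A(1) by blast
qed

lemma ideal_minimal_generators:
  fixes J :: "'a::field poly poly set"
  assumes J: "module.subspace (*) J" and e0: "e0 \<ge> 0" "\<And>e. e \<ge> e0 \<Longrightarrow> forms e \<subseteq> J"
  shows "\<exists>(n::nat) g a. (\<forall>k<n. g k \<in> J \<inter> forms (a k)) \<and>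
      (\<forall>e. J \<inter> forms e \<subseteq> ideal_gen (g ` {..<n})) \<and>
      (\<forall>v. (\<Sum>k<n. v k * g k) = 0 \<longrightarrow> (\<forall>k<n. const_coeff (v k) = 0))"
proof -
  have "\<exists>G. finite G \<and> G \<subseteq> (\<Union>e. J \<inter> forms e) \<and> (\<forall>e. J \<inter> forms e \<subseteq> ideal_gen G)"
  proof (rule module.finite_generation[OF module_times, where lo = 0 and hi = e0])
    show "J \<inter> forms e \<subseteq> {0}" if "e < 0" for e using forms_negative[OF that] by auto
    show "\<exists>G. finite G \<and> G \<subseteq> J \<inter> forms e \<and> J \<inter> forms e \<subseteq> ideal_gen G" for e
    proof -
      have "form_subspace J"
        by (intro vs.subspaceI module.subspace_0[OF module_times J]
            module.subspace_add[OF module_times J])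
          (auto simp only: scalar_eq_mult ideal_times_mult[OF J])
      then have "form_subspace (J \<inter> forms e)" by (intro vs.subspace_inter form_subspace_forms)
      then obtain G where G: "finite G" "G \<subseteq> J \<inter> forms e" "J \<inter> forms e \<subseteq> vs.span G"
        using form_subspace_finitely_spanned[of "J \<inter> forms e" e] by blast
      have "form_subspace (ideal_gen G)"
        by (intro vs.subspaceI module.span_zero[OF module_times] module.span_add[OF module_times])
          (auto simp only: scalar_eq_mult module.span_scale[OF module_times])
      then have "vs.span G \<subseteq> ideal_gen G"
        using module.span_superset[OF module_times] by (intro vs.span_minimal)
      then show ?thesis using G by blast
    qed
    show "J \<inter> forms e \<subseteq> ideal_gen (J \<inter> forms (e - 1))" if e: "e > e0" for e
    proof clarify
      fix f assume f: "f \<in> J" "f \<in> forms e"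
      have "const_coeff f = 0" using const_coeff_forms_nonzero[OF f(2)] e e0 by simp
      then obtain u v where uv: "u \<in> forms (e - 1)" "v \<in> forms (e - 1)" "f = var_x * u + var_y * v"
        using const_coeff_zero_decomp_form[OF f(2)] by blast
      have "forms (e - 1) \<subseteq> J" using e0(2)[of "e - 1"] e by simp
      then show "f \<in> ideal_gen (J \<inter> forms (e - 1))"
        unfolding uv(3) using uv(1,2)
        by (intro module.span_add[OF module_times] module.span_scale[OF module_times]
          module.span_base[OF module_times]) auto
    qed
  qed
  then obtain G where G: "finite G" "G \<subseteq> (\<Union>e. J \<inter> forms e)" "\<And>e. J \<inter> forms e \<subseteq> ideal_gen G"
    by blast
  show ?thesis
  proof (rule minimal_generators[OF module_times _ G])
    fix n :: nat and g a v and e :: int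
    assume "\<And>k. k < n \<Longrightarrow> g k \<in> J \<inter> forms (a k)" "(\<Sum>k<n. v k * g k) = 0"
    then show "(\<Sum>k<n. hcomp (e - a k) (v k) * g k) = 0"
      using hcomp_combination[of n g a e v] by simp
  qed
qed

text \<open>
  A vector \<open>v\<close> of the free module on the generators \<open>g k\<close> is encoded as the polynomial with
  coefficients \<open>v k\<close> in a further variable, so that the syzygies form a module under \<open>smult\<close>.
\<close>

definition syzygies ::
  "nat \<Rightarrow> (nat \<Rightarrow> 'a::field poly poly) \<Rightarrow> (nat \<Rightarrow> int) \<Rightarrow> int \<Rightarrow> 'a poly poly poly set" where
  "syzygies n g a e = {v. (\<forall>l\<ge>n. coeff v l = 0) \<and> (\<forall>l<n. coeff v l \<in> forms (e - a l)) \<and>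
     (\<Sum>l<n. coeff v l * g l) = 0}"

definition vector_of :: "nat \<Rightarrow> (nat \<Rightarrow> 'b::comm_monoid_add) \<Rightarrow> 'b poly" where
  "vector_of n v = (\<Sum>l<n. monom (v l) l)"

lemma coeff_vector_of: "coeff (vector_of n v) l = (if l < n then v l else 0)"
  by (simp add: vector_of_def coeff_sum)

lemma syzygies_finitely_spanned:
  fixes g :: "nat \<Rightarrow> 'a::field poly poly"
  shows "\<exists>G. finite G \<and> G \<subseteq> syzygies n g a e \<and> syzygies n g a e \<subseteq> module.span smult G"
proof -
  interpret W: vector_space "\<lambda>(c::'a) (v :: 'a poly poly poly). smult [:[:c:]:] v"
    by (rule vector_space_const_smult)
  let ?C = "\<Union>l<n. (\<lambda>(i, j) (v :: 'a poly poly poly). coeff (coeff (coeff v l) i) j) `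
    ({..nat (e - a l)} \<times> {..nat (e - a l)})"
  have "\<exists>G. finite G \<and> G \<subseteq> syzygies n g a e \<and> syzygies n g a e \<subseteq> W.span G"
  proof (rule W.finitely_spanned[of ?C])
    show "W.subspace (syzygies n g a e)"
    proof (rule W.subspaceI)
      show "0 \<in> syzygies n g a e" by (simp add: syzygies_def)
      show "x + y \<in> syzygies n g a e" if "x \<in> syzygies n g a e" "y \<in> syzygies n g a e" for x y
        using that by (auto simp: syzygies_def distrib_right sum.distrib intro: forms_add)
      show "smult [:[:c:]:] x \<in> syzygies n g a e" if "x \<in> syzygies n g a e" for c x
      proof -
        have "(\<Sum>l<n. coeff (smult [:[:c:]:] x) l * g l) = [:[:c:]:] * (\<Sum>l<n. coeff x l * g l)"
          unfolding coeff_smult sum_distrib_left mult.assoc ..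
        then show ?thesis
          using that forms_scalar[of _ _ c] by (auto simp: syzygies_def scalar_def)
      qed
    qed
    fix x assume x: "x \<in> syzygies n g a e" and 0: "\<And>c. c \<in> ?C \<Longrightarrow> c x = 0"
    show "x = 0"
    proof (rule poly_eqI)
      fix l
      show "coeff x l = coeff 0 l"
      proof (cases "l < n")
        case True
        have "coeff x l = 0"
        proof (rule forms_coordinates[of _ "e - a l"])
          show "coeff x l \<in> forms (e - a l)" using x True by (simp add: syzygies_def)
          show "coeff (coeff (coeff x l) i) j = 0" if "i \<le> nat (e - a l)" "j \<le> nat (e - a l)" for i j
            by (rule 0) (use True that in force)
        qed
        then show ?thesis by simp
      qed (use x in \<open>simp add: syzygies_def\<close>)
    qed
  qed auto
  then obtain G where G: "finite G" "G \<subseteq> syzygies n g a e" "syzygies n g a e \<subseteq> W.span G"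
    by blast
  have "W.subspace (module.span smult G)"
    by (intro W.subspaceI module.span_zero[OF module_smult] module.span_add[OF module_smult]
        module.span_scale[OF module_smult])
  then have "W.span G \<subseteq> module.span smult G"
    using module.span_superset[OF module_smult] by (intro W.span_minimal)
  then show ?thesis using G by blast
qed

text \<open>
  The degree bounds give finite generation: \<open>J\<close> is generated in degrees up to \<open>e\<^sub>0\<close>, its syzygies in
  degrees up to \<open>e\<^sub>0 + 1\<close>, and every degree is finite dimensional. An arbitrary syzygy is the sum of
  its homogeneous components, so homogeneous relations suffice for exactness.
\<close>

lemma presentation_exists:
  fixes J :: "'a::field poly poly set"
  assumes J: "module.subspace (*) J" and e0: "e0 \<ge> 0" "\<And>e. e \<ge> e0 \<Longrightarrow> forms e \<subseteq> J"
  shows "\<exists>n a g m b \<psi>. presents J n a g m b \<psi>"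
proof -
  obtain n :: nat and g a where g: "\<And>k. k < n \<Longrightarrow> g k \<in> J" "\<And>k. k < n \<Longrightarrow> g k \<in> forms (a k)"
    and gen': "\<And>e. J \<inter> forms e \<subseteq> ideal_gen (g ` {..<n})"
    and min: "\<And>v k. (\<Sum>k<n. v k * g k) = 0 \<Longrightarrow> k < n \<Longrightarrow> const_coeff (v k) = 0"
    using ideal_minimal_generators[OF assms] by blast
  have gen: "\<exists>v. h = (\<Sum>k<n. v k * g k)" if "h \<in> J" "h \<in> forms e" for h e
    using module.span_indexed[OF module_times, of h g n] gen' that by blast
  let ?M = "syzygies n g a"
  obtain lo where lo: "\<And>l. l < n \<Longrightarrow> lo \<le> a l"
    using bdd_below_finite[of "a ` {..<n}"] by (auto simp: bdd_below_def)
  have "\<exists>G. finite G \<and> G \<subseteq> (\<Union>e. ?M e) \<and> (\<forall>e. ?M e \<subseteq> module.span smult G)"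
  proof (rule module.finite_generation[OF module_smult, where lo = lo and hi = "e0 + 1"])
    show "?M e \<subseteq> {0}" if "e < lo" for e
    proof clarify
      fix v assume v: "v \<in> ?M e"
      have "coeff v l = 0" for l
      proof (cases "l < n")
        case True
        then have "coeff v l \<in> forms (e - a l)" using v by (simp add: syzygies_def)
        then show ?thesis using forms_negative[of "e - a l"] lo[OF True] that by auto
      qed (use v in \<open>simp add: syzygies_def\<close>)
      then show "v = 0" by (simp add: poly_eq_iff)
    qed
    show "\<exists>G. finite G \<and> G \<subseteq> ?M e \<and> ?M e \<subseteq> module.span smult G" for e
      by (rule syzygies_finitely_spanned)
    show "?M e \<subseteq> module.span smult (?M (e - 1))" if e: "e > e0 + 1" for e
    proof
      fix v assume v: "v \<in> ?M e"
      obtain p q where pq: "\<And>k. k < n \<Longrightarrow> coeff v k = var_x * p k + var_y * q k"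
        "\<And>k. k < n \<Longrightarrow> p k \<in> forms (e - 1 - a k)" "\<And>k. k < n \<Longrightarrow> q k \<in> forms (e - 1 - a k)"
        "(\<Sum>k<n. p k * g k) = 0" "(\<Sum>k<n. q k * g k) = 0"
        by (rule first_syzygies_divide[OF g(2) gen e0(2), where v = "coeff v" and e = e])
          (use e v min[of "coeff v"] in \<open>auto simp: syzygies_def\<close>)
      have "vector_of n p \<in> ?M (e - 1)" "vector_of n q \<in> ?M (e - 1)"
        using pq by (auto simp: syzygies_def coeff_vector_of)
      moreover have "v = smult var_x (vector_of n p) + smult var_y (vector_of n q)"
        using pq(1) v by (intro poly_eqI) (auto simp: syzygies_def coeff_vector_of)
      ultimately show "v \<in> module.span smult (?M (e - 1))"
        by (auto intro!: module.span_add[OF module_smult] module.span_scale[OF module_smult]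
          intro: module.span_base[OF module_smult])
    qed
  qed
  then obtain G where G: "finite G" "G \<subseteq> (\<Union>e. ?M e)" "\<And>e. ?M e \<subseteq> module.span smult G"
    by blast
  have "\<exists>(m::nat) s b. (\<forall>k<m. s k \<in> ?M (b k)) \<and> (\<forall>e. ?M e \<subseteq> module.span smult (s ` {..<m})) \<and>
      (\<forall>v. (\<Sum>k<m. smult (v k) (s k)) = 0 \<longrightarrow> (\<forall>k<m. const_coeff (v k) = 0))"
  proof (rule minimal_generators[OF module_smult _ G])
    fix m :: nat and s b v and e :: int
    assume s: "\<And>k. k < m \<Longrightarrow> s k \<in> ?M (b k)" and v: "(\<Sum>k<m. smult (v k) (s k)) = 0"
    show "(\<Sum>k<m. smult (hcomp (e - b k) (v k)) (s k)) = 0"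
    proof (rule poly_eqI)
      fix l
      show "coeff (\<Sum>k<m. smult (hcomp (e - b k) (v k)) (s k)) l = coeff 0 l"
      proof (cases "l < n")
        case True
        have "(\<Sum>k<m. v k * coeff (s k) l) = 0"
          using arg_cong[OF v, of "\<lambda>p. coeff p l"] by (simp add: coeff_sum)
        then have "(\<Sum>k<m. hcomp (e - a l - (b k - a l)) (v k) * coeff (s k) l) = 0"
          using hcomp_combination[of m "\<lambda>k. coeff (s k) l" "\<lambda>k. b k - a l" "e - a l" v] s True
          by (simp add: syzygies_def)
        then show ?thesis by (simp add: coeff_sum algebra_simps)
      qed (use s in \<open>simp add: coeff_sum syzygies_def\<close>)
    qed
  qed
  then obtain m :: nat and s b where s: "\<And>k. k < m \<Longrightarrow> s k \<in> ?M (b k)"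
    and sgen: "\<And>e. ?M e \<subseteq> module.span smult (s ` {..<m})"
    and smin: "\<And>v k. (\<Sum>k<m. smult (v k) (s k)) = 0 \<Longrightarrow> k < m \<Longrightarrow> const_coeff (v k) = 0"
    by blast
  let ?\<psi> = "\<lambda>k l. coeff (s k) l"
  have "\<exists>w. \<forall>l<n. v l = (\<Sum>k<m. w k * ?\<psi> k l)" if v: "(\<Sum>l<n. v l * g l) = 0" for v
  proof -
    \<comment> \<open>One finite set \<open>E\<close> of degrees must serve the components of all coordinates of \<open>v\<close>.\<close>
    have "\<forall>l. \<exists>A. finite A \<and> (\<forall>B. finite B \<longrightarrow> A \<subseteq> B \<longrightarrow> v l = (\<Sum>k\<in>B. hcomp k (v l)))"
      using sum_hcomp_superset by blast
    then obtain A where A: "\<And>l. finite (A l)"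
      "\<And>l B. finite B \<Longrightarrow> A l \<subseteq> B \<Longrightarrow> v l = (\<Sum>k\<in>B. hcomp k (v l))" by metis
    define E where "E = (\<Union>l<n. (\<lambda>k. k + a l) ` A l)"
    define c where "c e = vector_of n (\<lambda>l. hcomp (e - a l) (v l))" for e
    have fin: "finite E" using A(1) by (auto simp: E_def)
    have "c e \<in> ?M e" for e
      using hcomp_combination[of n g a e v] g(2) v
      by (auto simp: syzygies_def c_def coeff_vector_of hcomp_in_forms)
    then have "c e \<in> module.span smult (s ` {..<m})" for e using sgen by blast
    then have "(\<Sum>e\<in>E. c e) \<in> module.span smult (s ` {..<m})"
      by (intro module.span_sum[OF module_smult])
    then obtain w where w: "(\<Sum>e\<in>E. c e) = (\<Sum>k<m. smult (w k) (s k))"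
      using module.span_indexed[OF module_smult] by blast
    have "v l = (\<Sum>k<m. w k * ?\<psi> k l)" if l: "l < n" for l
    proof -
      have "inj_on (\<lambda>e. e - a l) E" by (auto simp: inj_on_def)
      moreover have "A l \<subseteq> (\<lambda>e. e - a l) ` E" using l by (force simp: E_def)
      ultimately have "v l = (\<Sum>e\<in>E. hcomp (e - a l) (v l))"
        using A(2)[of "(\<lambda>e. e - a l) ` E" l] fin by (simp add: sum.reindex)
      also have "\<dots> = coeff (\<Sum>e\<in>E. c e) l" using l by (simp add: c_def coeff_sum coeff_vector_of)
      finally show ?thesis unfolding w by (simp add: coeff_sum)
    qed
    then show ?thesis by blast
  qed
  moreover have "(\<Sum>l<n. v l * g l) = 0" if v: "\<forall>l<n. v l = (\<Sum>k<m. w k * ?\<psi> k l)" for v w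
  proof -
    have "(\<Sum>l<n. v l * g l) = (\<Sum>l<n. \<Sum>k<m. w k * (?\<psi> k l * g l))"
      using v by (simp add: sum_distrib_right mult.assoc)
    also have "\<dots> = (\<Sum>k<m. w k * (\<Sum>l<n. ?\<psi> k l * g l))"
      by (subst sum.swap) (simp add: sum_distrib_left)
    also have "\<dots> = 0" using s by (simp add: syzygies_def)
    finally show ?thesis .
  qed
  moreover have "const_coeff (v k) = 0"
    if v: "\<forall>l<n. (\<Sum>k<m. v k * ?\<psi> k l) = 0" and k: "k < m" for v k
  proof (rule smin[OF _ k])
    show "(\<Sum>k<m. smult (v k) (s k)) = 0"
    proof (rule poly_eqI)
      fix l
      show "coeff (\<Sum>k<m. smult (v k) (s k)) l = coeff 0 l"
        using v s by (cases "l < n") (simp_all add: coeff_sum syzygies_def)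
    qed
  qed
  moreover have "?\<psi> k l \<in> forms (b k - a l)" if "k < m" "l < n" for k l
    using s[OF that(1)] that(2) by (simp add: syzygies_def)
  ultimately have "presents J n a g m b ?\<psi>"
    unfolding presents_def using g gen min by (intro conjI; blast)
  then show ?thesis by blast
qed

section \<open>The regularity of an ideal of finite colength\<close>

text \<open>
  Since second syzygies vanish, the presentation extended by zero modules is exact.
\<close>

lemma presents_resolution:
  assumes P: "presents J n a g m b \<psi>"
  shows "minimal_graded_free_resolution (*) (\<lambda>e. J \<inter> forms e)
    (\<lambda>i. if i = 0 then n else if i = 1 then m else 0) (\<lambda>i. if i = 0 then a else b) g
    (\<lambda>i. if i = 0 then \<psi> else (\<lambda>k l. 0))"
proof -
  have \<psi>: "const_coeff (\<psi> k l) = 0" if k: "k < m" and "l < n" for k l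
  proof (rule presentsD(7)[OF P _ \<open>l < n\<close>])
    show "(\<Sum>l<n. \<psi> k l * g l) = 0"
      by (rule presentsD(6)[OF P, where w = "\<lambda>i. if i = k then 1 else 0"])
        (use k in \<open>simp add: if_distrib[of "\<lambda>c. c * _"] sum.delta cong: if_cong\<close>)
  qed
  have ex: "(\<Sum>k<n. v k * g k) = 0 \<longleftrightarrow> (\<exists>w. \<forall>l<n. v l = (\<Sum>k<m. w k * \<psi> k l))" for v
    using P unfolding presents_def by blast
  have inj: "(\<forall>l<n. (\<Sum>k<m. v k * \<psi> k l) = 0) \<longleftrightarrow> (\<forall>k<m. v k = 0)" for v
    using second_syzygies_vanish[OF P, of v] by auto
  show ?thesis
    unfolding minimal_graded_free_resolution_def maximal_ideal_iff
  proof (intro conjI)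
    show "\<forall>i v. (\<forall>l<if i = 0 then n else if i = 1 then m else 0.
               (\<Sum>k<if Suc i = 0 then n else if Suc i = 1 then m else 0.
                   v k * (if i = 0 then \<psi> else (\<lambda>k l. 0)) k l) = 0) \<longleftrightarrow>
          (\<exists>w. \<forall>k<if Suc i = 0 then n else if Suc i = 1 then m else 0.
               v k = (\<Sum>k'<if Suc (Suc i) = 0 then n else if Suc (Suc i) = 1 then m else 0.
                   w k' * (if Suc i = 0 then \<psi> else (\<lambda>k l. 0)) k' k))"
      using inj by auto
  qed (use presentsD(1-4)[OF P] ex \<psi> in auto)
qed

text \<open>
  The map from \<open>F 1\<close> to \<open>F 0\<close> is injective, so the map from \<open>F 2\<close> to \<open>F 1\<close> is zero, and minimality makes
  \<open>F 2\<close> and then all further modules vanish.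
\<close>

lemma resolution_presents:
  fixes J :: "'a::field poly poly set"
  assumes R: "minimal_graded_free_resolution (*) (\<lambda>e. J \<inter> forms e) n a g \<phi>"
  shows "presents J (n 0) (a 0) g (n 1) (a 1) (\<phi> 0)"
    and "i \<ge> 2 \<Longrightarrow> n i = 0"
proof -
  have 1: "\<forall>k<n 0. g k \<in> J \<inter> forms (a 0 k)"
    and 2: "\<And>i k l. k < n (Suc i) \<Longrightarrow> l < n i \<Longrightarrow> \<phi> i k l \<in> forms (a (Suc i) k - a i l)"
    and 3: "\<forall>e. \<forall>m\<in>J \<inter> forms e. \<exists>v. m = (\<Sum>k<n 0. v k * g k)"
    and 4: "\<And>v. (\<Sum>k<n 0. v k * g k) = 0 \<longleftrightarrow>
          (\<exists>w. \<forall>l<n 0. v l = (\<Sum>k<n 1. w k * \<phi> 0 k l))"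
    and 5: "\<And>i v. (\<forall>l<n i. (\<Sum>k<n (Suc i). v k * \<phi> i k l) = 0) \<longleftrightarrow>
          (\<exists>w. \<forall>k<n (Suc i). v k = (\<Sum>m<n (Suc (Suc i)). w m * \<phi> (Suc i) m k))"
    and 6: "\<And>i k l. k < n (Suc i) \<Longrightarrow> l < n i \<Longrightarrow> const_coeff (\<phi> i k l) = 0"
    using R unfolding minimal_graded_free_resolution_def maximal_ideal_iff by blast+
  have image: "const_coeff (\<Sum>k<n (Suc i). w k * \<phi> i k l) = 0" if "l < n i" for i w l
    using 6 that by (simp add: coeff_sum const_coeff_mult)
  have 7: "const_coeff (v k) = 0" if v: "(\<Sum>k<n 0. v k * g k) = 0" and k: "k < n 0" for v k
  proof -
    obtain w where "\<forall>l<n 0. v l = (\<Sum>k<n 1. w k * \<phi> 0 k l)" using 4 v by blast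
    then show ?thesis using image[OF k, of w] k by simp
  qed
  have 8: "const_coeff (v k) = 0"
    if v: "\<forall>l<n i. (\<Sum>k<n (Suc i). v k * \<phi> i k l) = 0" and k: "k < n (Suc i)" for i v k
  proof -
    obtain w where "\<forall>k<n (Suc i). v k = (\<Sum>m<n (Suc (Suc i)). w m * \<phi> (Suc i) m k)"
      using 5[of i v] v by blast
    then show ?thesis using image[OF k, of w] k by simp
  qed
  show P: "presents J (n 0) (a 0) g (n 1) (a 1) (\<phi> 0)"
    unfolding presents_def using 1 2[of _ 0] 3 4 7 8[of 0] by simp
  \<comment> \<open>If a map of the resolution is zero, the next module consists of boundaries, whose
    entries have no constant term, so it cannot contain a basis vector.\<close>
  have zero: "n (Suc i) = 0" if "\<And>k l. k < n (Suc i) \<Longrightarrow> l < n i \<Longrightarrow> \<phi> i k l = 0" for i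
  proof (rule ccontr)
    assume "n (Suc i) \<noteq> 0"
    then show False using 8[of i "\<lambda>_. 1" 0] that by simp
  qed
  have "n 2 = 0"
  proof -
    have "\<phi> 1 k l = 0" if k: "k < n 2" and l: "l < n 1" for k l
    proof (rule second_syzygies_vanish[OF P _ l])
      have "\<exists>w. \<forall>l<n 1. \<phi> 1 k l = (\<Sum>m<n 2. w m * \<phi> 1 m l)"
        by (rule exI[of _ "\<lambda>i. if i = k then 1 else 0"])
          (use k in \<open>simp add: if_distrib[of "\<lambda>c. c * _"] sum.delta cong: if_cong\<close>)
      then show "(\<Sum>l<n 1. \<phi> 1 k l * \<phi> 0 l j) = 0" if "j < n 0" for j
        using 5[of 0 "\<phi> 1 k"] that by (simp add: numeral_2_eq_2)
    qed
    then show ?thesis using zero[of 1] by (simp add: numeral_2_eq_2)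
  qed
  then have "n (2 + j) = 0" for j
  proof (induction j)
    case (Suc j)
    have "n (Suc (2 + j)) = 0" by (rule zero) (use Suc in simp)
    then show ?case by simp
  qed simp
  from this[of "i - 2"] show "n i = 0" if "i \<ge> 2"
    using that by (simp only: le_add_diff_inverse)
qed

text \<open>
  In every minimal resolution generators have degree at most \<open>e\<^sub>0\<close> and relations degree at most
  \<open>e\<^sub>0 + 1\<close>, with equality for some relation. So the description of the regularity is satisfied by
  \<open>e\<^sub>0\<close> and by no other number.
\<close>

theorem ideal_regularity_eq:
  fixes J :: "'a::field poly poly set"
  assumes J: "module.subspace (*) J" and e0: "e0 \<ge> 0" "forms e0 \<subseteq> J" "\<not> forms (e0 - 1) \<subseteq> J"
  shows "ideal_regularity J = e0"
proof -
  have up: "forms e \<subseteq> J" if "e \<ge> e0" for e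
    using forms_upward[OF J e0(2,1) that] .
  have bounds: "a i k - int i \<le> e0" and attained: "\<exists>k<n 1. a 1 k - 1 = e0"
    if R: "minimal_graded_free_resolution (*) (\<lambda>e. J \<inter> forms e) n a g \<phi>" and k: "k < n i"
    for n a g \<phi> i k
  proof -
    note P = resolution_presents(1)[OF R]
    have "i = 0 \<or> i = 1"
    proof (rule ccontr)
      assume "\<not> ?thesis"
      then have "n i = 0" by (intro resolution_presents(2)[OF R]) auto
      then show False using k by simp
    qed
    then show "a i k - int i \<le> e0"
      using generator_degree_bound[OF P up e0(1)] relation_degree_bound[OF P up e0(1)] k by auto
    show "\<exists>k<n 1. a 1 k - 1 = e0"
      by (rule relation_degree_attained[OF P J e0(2,3,1)])
  qed
  show ?thesis
    unfolding ideal_regularity_def cm_regularity_def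
  proof (rule the_equality)
    obtain n a g m b \<psi> where P: "presents J n a g m b \<psi>"
      using presentation_exists[OF J e0(1) up] by blast
    note R = presents_resolution[OF P]
    obtain k where k: "k < m" "b k - 1 = e0"
      using relation_degree_attained[OF P J e0(2,3,1)] by blast
    show "\<exists>n a g \<phi>. minimal_graded_free_resolution (*) (\<lambda>e. J \<inter> forms e) n a g \<phi> \<and>
        (\<exists>i. \<exists>k<n i. e0 = a i k - int i) \<and> (\<forall>i. \<forall>k<n i. a i k - int i \<le> e0)"
    proof (intro exI conjI)
      show "\<forall>i. \<forall>k<(if i = 0 then n else if i = 1 then m else 0).
          (if i = 0 then a else b) k - int i \<le> e0"
        using bounds[OF R] by blast
      show "k < (if (1::nat) = 0 then n else if (1::nat) = 1 then m else 0)"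
        "e0 = (if (1::nat) = 0 then a else b) k - int 1"
        using k by auto
    qed (rule R)
  next
    fix \<rho>
    assume "\<exists>n a g \<phi>. minimal_graded_free_resolution (*) (\<lambda>e. J \<inter> forms e) n a g \<phi> \<and>
        (\<exists>i. \<exists>k<n i. \<rho> = a i k - int i) \<and> (\<forall>i. \<forall>k<n i. a i k - int i \<le> \<rho>)"
    then obtain n a g \<phi> i k
      where R: "minimal_graded_free_resolution (*) (\<lambda>e. J \<inter> forms e) n a g \<phi>"
        and k: "k < n i" "\<rho> = a i k - int i" and max: "\<forall>i. \<forall>k<n i. a i k - int i \<le> \<rho>"
      by blast
    have "\<rho> \<le> e0" using bounds[OF R k(1)] k(2) by simp
    moreover have "e0 \<le> \<rho>"
      using attained[OF R k(1)] max by force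
    ultimately show "\<rho> = e0" by simp
  qed
qed

section \<open>Linear forms\<close>

text \<open>
  A binary form in \<open>f, g\<close> corresponds to a polynomial \<open>P\<close> of degree at most \<open>m\<close>: a root of \<open>P\<close> splits off
  a factor \<open>g - s f\<close>, and a drop of the degree below \<open>m\<close> splits off a factor \<open>f\<close>. It is used both for
  \<open>y, x\<close>, to factor forms, and for two elements of \<open>V\<close>.
\<close>

lemma binary_factorization:
  fixes P :: "'a::alg_closed_field poly"
  assumes "P \<noteq> 0" "degree P \<le> m"
  shows "\<exists>c ls. c \<noteq> 0 \<and> length ls = m \<and> set ls \<subseteq> insert f (range (\<lambda>s. g - scalar s f)) \<and>
    (\<Sum>j\<le>m. scalar (coeff P j) (g ^ j * f ^ (m - j))) = scalar c (prod_list ls)"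
  using assms
proof (induction m arbitrary: P)
  case 0
  then have "coeff P 0 \<noteq> 0" by (metis le_zero_eq leading_coeff_0_iff)
  then show ?case by (intro exI[of _ "coeff P 0"] exI[of _ "[]"]) simp
next
  case (Suc m)
  let ?H = "\<lambda>m P. \<Sum>j\<le>m. scalar (coeff P j) (g ^ j * f ^ (m - j))"
  show ?case
  proof (cases "degree P \<le> m")
    case True
    obtain c ls where IH: "c \<noteq> 0" "length ls = m" "set ls \<subseteq> insert f (range (\<lambda>s. g - scalar s f))"
      "?H m P = scalar c (prod_list ls)" using Suc.IH[OF Suc.prems(1) True] by blast
    have "coeff P (Suc m) = 0" using True by (simp add: coeff_eq_0)
    then have "?H (Suc m) P = (\<Sum>j\<le>m. f * scalar (coeff P j) (g ^ j * f ^ (m - j)))"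
      by (auto simp: scalar_def Suc_diff_le ac_simps intro!: sum.cong)
    also have "\<dots> = scalar c (prod_list (f # ls))"
      unfolding sum_distrib_left[symmetric] IH(4) by (simp add: scalar_eq_mult mult.left_commute)
    finally show ?thesis using IH(1-3) by (intro exI[of _ c] exI[of _ "f # ls"]) simp
  next
    case False
    then obtain s where "poly P s = 0" using alg_closed_imp_poly_has_root[of P] by auto
    then obtain Q where Q: "P = [:- s, 1:] * Q" by (metis dvdE poly_eq_0_iff_dvd)
    have "Q \<noteq> 0" using Suc.prems(1) Q by auto
    then have "degree P = Suc (degree Q)" unfolding Q by (subst degree_mult_eq) auto
    then have deg: "degree Q \<le> m" using Suc.prems(2) by simp
    obtain c ls where IH: "c \<noteq> 0" "length ls = m" "set ls \<subseteq> insert f (range (\<lambda>s. g - scalar s f))"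
      "?H m Q = scalar c (prod_list ls)" using Suc.IH[OF \<open>Q \<noteq> 0\<close> deg] by blast
    have P: "P = pCons 0 Q - smult s Q" by (simp add: Q)
    have split: "?H (Suc m) (p - q) = ?H (Suc m) p - ?H (Suc m) q" for p q
      by (simp only: coeff_diff vs.scale_left_diff_distrib sum_subtractf)
    have "?H (Suc m) (pCons 0 Q) = (\<Sum>j\<le>m. g * scalar (coeff Q j) (g ^ j * f ^ (m - j)))"
      by (subst sum.atMost_Suc_shift) (simp add: scalar_eq_mult ac_simps)
    also have "\<dots> = g * ?H m Q" by (rule sum_distrib_left[symmetric])
    finally have 1: "?H (Suc m) (pCons 0 Q) = g * ?H m Q" .
    have "coeff Q (Suc m) = 0" using deg by (simp add: coeff_eq_0)
    then have "?H (Suc m) (smult s Q) = (\<Sum>j\<le>m. scalar s f * scalar (coeff Q j) (g ^ j * f ^ (m - j)))"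
      by (auto simp: scalar_def Suc_diff_le ac_simps mult_smult_left mult_smult_right intro!: sum.cong)
    also have "\<dots> = scalar s f * ?H m Q" by (rule sum_distrib_left[symmetric])
    finally have 2: "?H (Suc m) (smult s Q) = scalar s f * ?H m Q" .
    have "?H (Suc m) P = (g - scalar s f) * ?H m Q"
      unfolding P split 1 2 by (simp only: left_diff_distrib)
    also have "\<dots> = scalar c (prod_list ((g - scalar s f) # ls))"
      unfolding IH(4) by (simp add: scalar_eq_mult mult.left_commute)
    finally show ?thesis using IH(1-3) by (intro exI[of _ c] exI[of _ "(g - scalar s f) # ls"]) auto
  qed
qed

text \<open>
  One linear form for each point of the projective line; every linear form is a scalar multiple
  of one of these.
\<close>

definition lines :: "'a::field poly poly set" where
  "lines = insert var_y (range (\<lambda>s. var_x - scalar s var_y))"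

lemma lines_forms: "l \<in> lines \<Longrightarrow> l \<in> forms 1"
  by (auto simp: lines_def intro: var_x_forms var_y_forms forms_diff forms_scalar)

lemma form_expansion:
  assumes "f \<in> forms (int m)"
  shows "f = (\<Sum>j\<le>m. scalar (coeff (coeff f (m - j)) j) (var_x ^ j * var_y ^ (m - j)))"
proof (intro poly_eqI)
  fix i k
  have mon: "coeff (coeff (var_x ^ j * var_y ^ n :: 'a poly poly) i) k = (if i = n \<and> k = j then 1 else 0)" for j n
  proof -
    have "var_x ^ j * var_y ^ n = monom (monom (1::'a) j) n"
    proof -
      have "var_y ^ n = monom (1::'a poly) n"
        unfolding var_y_def by (simp add: monom_altdef)
      moreover have "var_x ^ j = [:monom (1::'a) j:]"
        unfolding var_x_def by (induction j) (simp_all add: one_pCons monom_Suc monom_0)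
      ultimately show ?thesis by (simp add: smult_monom)
    qed
    then show ?thesis by (auto simp: coeff_monom)
  qed
  have "coeff (coeff (\<Sum>j\<le>m. scalar (coeff (coeff f (m - j)) j) (var_x ^ j * var_y ^ (m - j))) i) k
      = (\<Sum>j\<le>m. coeff (coeff f (m - j)) j * (if i = m - j \<and> k = j then 1 else 0))"
    by (simp add: coeff_sum scalar_def mon)
  also have "\<dots> = (\<Sum>j\<le>m. if j = k then (if i = m - k then coeff (coeff f i) k else 0) else 0)"
    by (intro sum.cong) auto
  also have "\<dots> = (if k \<le> m \<and> i = m - k then coeff (coeff f i) k else 0)"
    by (simp add: sum.delta)
  also have "\<dots> = coeff (coeff f i) k"
  proof (cases "coeff (coeff f i) k = 0")
    case False
    then have "int (i + k) = int m" using assms unfolding forms_def by blast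
    then show ?thesis by auto
  qed auto
  finally show "coeff (coeff f i) k =
      coeff (coeff (\<Sum>j\<le>m. scalar (coeff (coeff f (m - j)) j) (var_x ^ j * var_y ^ (m - j))) i) k" ..
qed

lemma form_factorization:
  fixes f :: "'a::alg_closed_field poly poly"
  assumes f: "f \<in> forms (int m)" "f \<noteq> 0"
  obtains c ls where "c \<noteq> 0" "length ls = m" "set ls \<subseteq> lines" "f = scalar c (prod_list ls)"
proof -
  define P where "P = (\<Sum>j\<le>m. monom (coeff (coeff f (m - j)) j) j)"
  have c: "coeff P j = (if j \<le> m then coeff (coeff f (m - j)) j else 0)" for j
    by (simp add: P_def coeff_sum)
  then have eq: "(\<Sum>j\<le>m. scalar (coeff P j) (var_x ^ j * var_y ^ (m - j))) = f"
    using form_expansion[OF f(1)] by simp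
  then have "P \<noteq> 0" using f(2) by auto
  moreover have "degree P \<le> m" using c by (intro degree_le) auto
  ultimately show ?thesis
    using binary_factorization[of P m var_y var_x] that unfolding eq lines_def by blast
qed

text \<open>
  Reduction modulo a linear form \<open>l\<close>: with a second linear form \<open>h\<close> and the evaluation \<open>ev\<close> at a
  point where \<open>l\<close> vanishes and \<open>h\<close> is \<open>1\<close>, a form \<open>f\<close> of degree \<open>e\<close> is congruent to \<open>ev f h\<^sup>e\<close>.
\<close>

definition line_evaluation ::
  "'a::field poly poly \<Rightarrow> 'a poly poly \<Rightarrow> ('a poly poly \<Rightarrow> 'a) \<Rightarrow> bool" where
  "line_evaluation l h ev \<longleftrightarrow> h \<in> forms 1 \<and> ev l = 0 \<and> ev h = 1 \<and> ev 1 = 1 \<and>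
     (\<forall>f g. ev (f * g) = ev f * ev g) \<and>
     (\<forall>e. \<forall>f\<in>forms (int e). \<exists>u\<in>forms (int e - 1). f = l * u + scalar (ev f) (h ^ e))"

lemma line_evaluation_exists:
  fixes l :: "'a::field poly poly"
  assumes "l \<in> lines"
  shows "\<exists>h ev. line_evaluation l h ev"
proof -
  \<comment> \<open>It suffices that \<open>x\<close> and \<open>y\<close> are, modulo \<open>l\<close>, their values times \<open>h\<close>.\<close>
  have main: ?thesis if h: "h \<in> forms 1" and ev: "ev l = 0" "ev h = (1::'a)"
    "\<And>f g. ev (f + g) = ev f + ev g" "\<And>f g. ev (f * g) = ev f * ev g" "\<And>c. ev [:[:c:]:] = c"
    and x: "\<exists>a. var_x = scalar a l + scalar (ev var_x) h"
    and y: "\<exists>a. var_y = scalar a l + scalar (ev var_y) h" for h ev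
  proof -
    have "\<exists>u\<in>forms (int e - 1). f = l * u + scalar (ev f) (h ^ e)" if "f \<in> forms (int e)" for f e
      using that
    proof (induction e arbitrary: f)
      case 0
      then have "f = [:[:const_coeff f:]:]" by (intro forms_0_const) simp
      then have "f = scalar (ev f) 1" using ev(5) by (metis mult.right_neutral scalar_eq_mult)
      then show ?case by (intro bexI[of _ 0]) auto
    next
      case (Suc e)
      have l1: "l \<in> forms 1" using assms by (rule lines_forms)
      have "const_coeff f = 0" using const_coeff_forms_nonzero[OF Suc.prems] by simp
      then obtain p q where pq: "p \<in> forms (int e)" "q \<in> forms (int e)" "f = var_x * p + var_y * q"
        using const_coeff_zero_decomp_form[OF Suc.prems] by auto
      obtain u v where u: "u \<in> forms (int e - 1)" "p = l * u + scalar (ev p) (h ^ e)"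
        and v: "v \<in> forms (int e - 1)" "q = l * v + scalar (ev q) (h ^ e)"
        using Suc.IH pq by blast
      obtain a b where a: "var_x = scalar a l + scalar (ev var_x) h"
        and b: "var_y = scalar b l + scalar (ev var_y) h" using x y by blast
      define w where "w = scalar a p + scalar (ev var_x) (h * u) + scalar b q + scalar (ev var_y) (h * v)"
      have hu: "h * u \<in> forms (int e)" "h * v \<in> forms (int e)"
        using forms_mult[OF h u(1)] forms_mult[OF h v(1)] by simp_all
      have "w \<in> forms (int e)"
        unfolding w_def using pq hu by (intro forms_add forms_scalar)
      moreover have "f = l * w + scalar (ev f) (h ^ Suc e)"
      proof -
        have X: "var_x * p = l * (scalar a p + scalar (ev var_x) (h * u)) + scalar (ev var_x * ev p) (h ^ Suc e)"
        proof -
          have "var_x * p = scalar a l * p + scalar (ev var_x) h * (l * u + scalar (ev p) (h ^ e))"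
            using a u(2) by (metis distrib_right)
          then show ?thesis by (simp add: scalar_def algebra_simps smult_add_right)
        qed
        have Y: "var_y * q = l * (scalar b q + scalar (ev var_y) (h * v)) + scalar (ev var_y * ev q) (h ^ Suc e)"
        proof -
          have "var_y * q = scalar b l * q + scalar (ev var_y) h * (l * v + scalar (ev q) (h ^ e))"
            using b v(2) by (metis distrib_right)
          then show ?thesis by (simp add: scalar_def algebra_simps smult_add_right)
        qed
        have "ev f = ev var_x * ev p + ev var_y * ev q" using pq(3) ev(3,4) by simp
        then show ?thesis unfolding pq(3) X Y w_def
          by (simp only: distrib_left vs.scale_left_distrib add.assoc add.left_commute add.commute)
      qed
      ultimately show ?case by (intro bexI[of _ w]) auto
    qed
    moreover have "ev 1 = 1" using ev(5)[of 1] by (simp add: one_pCons)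
    ultimately have "line_evaluation l h ev"
      using h ev(1,2,4) unfolding line_evaluation_def by blast
    then show ?thesis by blast
  qed
  have evals: "poly (poly (f + g) [:q:]) p = poly (poly f [:q:]) p + poly (poly g [:q:]) p"
    "poly (poly (f * g) [:q:]) p = poly (poly f [:q:]) p * poly (poly g [:q:]) p"
    "poly (poly [:[:c:]:] [:q:]) p = c" for f g and p q c :: 'a
    by simp_all
  show ?thesis
  proof (cases "l = var_y")
    case True
    show ?thesis
      by (rule main[of var_x "\<lambda>f. poly (poly f [:0:]) 1"])
        (auto simp: True var_x_forms[unfolded var_x_def] var_x_def var_y_def scalar_def
          intro: exI[of _ 0] exI[of _ 1])
  next
    case False
    then obtain s where l: "l = var_x - scalar s var_y" using assms by (auto simp: lines_def)
    show ?thesis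
      by (rule main[of var_y "\<lambda>f. poly (poly f [:1:]) s"])
        (auto simp: l var_y_forms[unfolded var_y_def] var_x_def var_y_def scalar_def
          intro: exI[of _ 0] exI[of _ 1])
  qed
qed

text \<open>
  Modulo \<open>l\<close> both forms are multiples of powers of the same \<open>h\<close>, and for \<open>u\<close> the factor is nonzero.
\<close>

lemma line_division:
  fixes l :: "'a::field poly poly"
  assumes "l \<in> lines" "u \<in> forms (int a)" "\<not> l dvd u" "w \<in> forms (int b)" "a \<le> b"
  shows "\<exists>s\<in>forms (int b - int a). \<exists>v\<in>forms (int b - 1). w = s * u + l * v"
proof -
  obtain h ev where "line_evaluation l h ev" using line_evaluation_exists assms(1) by blast
  then have h: "h \<in> forms 1" and ev: "ev l = 0" "ev h = 1" "ev 1 = 1" "\<And>f g. ev (f * g) = ev f * ev g"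
    "\<And>e f. f \<in> forms (int e) \<Longrightarrow> \<exists>u\<in>forms (int e - 1). f = l * u + scalar (ev f) (h ^ e)"
    unfolding line_evaluation_def by blast+
  obtain u' where u': "u' \<in> forms (int a - 1)" "u = l * u' + scalar (ev u) (h ^ a)"
    using ev(5)[OF assms(2)] by blast
  obtain w' where w': "w' \<in> forms (int b - 1)" "w = l * w' + scalar (ev w) (h ^ b)"
    using ev(5)[OF assms(4)] by blast
  have nz: "ev u \<noteq> 0" using u'(2) assms(3) by (metis add.right_neutral dvd_triv_left vs.scale_zero_left)
  define s where "s = scalar (ev w / ev u) (h ^ (b - a))"
  have "h ^ (b - a) \<in> forms (int b - int a)"
    using forms_power[OF h, of "b - a"] assms(5) by (simp add: of_nat_diff)
  then have s: "s \<in> forms (int b - int a)" unfolding s_def by (rule forms_scalar)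
  have "h ^ b = h ^ (b - a) * h ^ a" using assms(5) by (simp flip: power_add)
  then have "s * scalar (ev u) (h ^ a) = scalar (ev w) (h ^ b)"
    using nz by (simp add: s_def scalar_def)
  then have "s * u = s * (l * u') + scalar (ev w) (h ^ b)"
    using u'(2) by (metis distrib_left)
  then have "scalar (ev w) (h ^ b) = s * u - s * (l * u')" by simp
  then have "w = l * w' + (s * u - s * (l * u'))" using w'(2) by metis
  then have "w = s * u + l * (w' - s * u')" by (simp add: algebra_simps)
  moreover have "w' - s * u' \<in> forms (int b - 1)"
    using forms_diff[OF w'(1), of "s * u'"] forms_mult[OF s u'(1)] by simp
  ultimately show ?thesis using s by blast
qed

text \<open>
  A form is divisible by \<open>l\<close> if its evaluation vanishes, and the evaluation is multiplicative.
\<close>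

lemma line_prime:
  fixes l :: "'a::field poly poly"
  assumes "l \<in> lines" "u \<in> forms a" "v \<in> forms b" "l dvd u * v"
  shows "l dvd u \<or> l dvd v"
proof -
  obtain h ev where "line_evaluation l h ev" using line_evaluation_exists assms(1) by blast
  then have h: "h \<in> forms 1" and ev: "ev l = 0" "ev h = 1" "ev 1 = 1" "\<And>f g. ev (f * g) = ev f * ev g"
    "\<And>e f. f \<in> forms (int e) \<Longrightarrow> \<exists>u\<in>forms (int e - 1). f = l * u + scalar (ev f) (h ^ e)"
    unfolding line_evaluation_def by blast+
  have dvd: "l dvd f" if "f \<in> forms e" "ev f = 0" for f e
  proof (cases "e < 0")
    case True
    then have "f = 0" using that(1) forms_negative[OF True] by blast
    then show ?thesis by simp
  next
    case False
    then have "f \<in> forms (int (nat e))" using that by simp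
    from ev(5)[OF this] obtain u where "f = l * u + scalar (ev f) (h ^ nat e)" by blast
    then have "f = l * u" using that by simp
    then show ?thesis by simp
  qed
  have "ev u * ev v = 0" using assms(4) ev(1,4) by (metis dvdE mult_zero_left)
  then show ?thesis using dvd assms(2,3) by auto
qed

lemma line_avoiding_form:
  fixes l :: "'a::field poly poly"
  assumes "l \<in> lines"
  shows "\<exists>h\<in>forms (int n). \<not> l dvd h"
proof -
  obtain h ev where "line_evaluation l h ev" using line_evaluation_exists assms(1) by blast
  then have h: "h \<in> forms 1" and ev: "ev l = 0" "ev h = 1" "ev 1 = 1" "\<And>f g. ev (f * g) = ev f * ev g"
    "\<And>e f. f \<in> forms (int e) \<Longrightarrow> \<exists>u\<in>forms (int e - 1). f = l * u + scalar (ev f) (h ^ e)"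
    unfolding line_evaluation_def by blast+
  have "ev (h ^ n) = 1" by (induction n) (simp_all add: ev)
  then have "\<not> l dvd h ^ n" using ev(1,4) by (metis dvdE mult_zero_left zero_neq_one)
  moreover have "h ^ n \<in> forms (int n)" using forms_power[OF h, of n] by simp
  ultimately show ?thesis by blast
qed

lemma line_nonzero: "l \<in> lines \<Longrightarrow> l \<noteq> 0"
  by (auto simp: lines_def var_x_def var_y_def scalar_def)

lemma form_dvd_degree:
  fixes p :: "'a::field poly poly"
  assumes "p \<in> forms a" "g \<in> forms b" "g \<noteq> 0" "p dvd g"
  shows "a \<le> b"
proof -
  obtain k where k: "g = p * k" using assms(4) by blast
  then have "p \<noteq> 0" "k \<noteq> 0" using assms(3) by auto
  have "k \<in> forms (b - a)" using form_factor[OF assms(1) \<open>p \<noteq> 0\<close>] assms(2) k by simp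
  then show ?thesis using forms_negative[of "b - a"] \<open>k \<noteq> 0\<close> by force
qed

lemma line_not_unit: "l \<in> lines \<Longrightarrow> \<not> l dvd 1"
  using form_dvd_degree[OF lines_forms one_in_forms, of l] by auto

lemma line_prime_power:
  assumes l: "l \<in> lines" and f: "f \<in> forms a" and "l dvd f ^ t"
  shows "l dvd f"
  using assms(3)
proof (induction t)
  case 0
  then show ?case using line_not_unit[OF l] by simp
next
  case (Suc t)
  then show ?case using line_prime[OF l f forms_power[OF f, of t]] by auto
qed

lemma line_dvd_prod_list:
  "l \<in> set ls \<Longrightarrow> (l :: 'a::comm_monoid_mult) dvd prod_list ls"
  by (induction ls) auto

text \<open>
  Modulo a linear form \<open>l\<close> not dividing \<open>u\<close>, every form of degree at least that of \<open>u\<close> is a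
  multiple of \<open>u\<close>. Peeling off one factor at a time, an ideal that contains such a form of small
  degree for every factor \<open>l\<close> of a product of linear forms contains all forms modulo that product.
\<close>

lemma forms_covered:
  fixes A :: "'a::field poly poly set"
  assumes A: "module.subspace (*) A" and "set ls \<subseteq> lines"
    and "\<And>l. l \<in> set ls \<Longrightarrow> \<exists>u\<in>A. \<exists>k. u \<in> forms (int k) \<and> \<not> l dvd u \<and> k + length ls \<le> e + 1"
    and "f \<in> forms (int e)"
  shows "\<exists>a\<in>A. \<exists>w\<in>forms (int e - int (length ls)). f = a + prod_list ls * w"
  using assms(2-4)
proof (induction ls)
  case Nil
  then show ?case using module.subspace_0[OF module_times A] by (intro bexI[of _ 0] bexI[of _ f]) auto
next
  case (Cons l ls)
  have "\<exists>u\<in>A. \<exists>k. u \<in> forms (int k) \<and> \<not> l' dvd u \<and> k + length ls \<le> e + 1" if "l' \<in> set ls" for l'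
    using Cons.prems(2)[of l'] that by fastforce
  then obtain a w where a: "a \<in> A" and w: "w \<in> forms (int e - int (length ls))"
    and f: "f = a + prod_list ls * w"
    using Cons.IH Cons.prems by auto
  obtain u k where u: "u \<in> A" "u \<in> forms (int k)" "\<not> l dvd u" "k + length (l # ls) \<le> e + 1"
    using Cons.prems(2)[of l] by auto
  have w': "w \<in> forms (int (e - length ls))" using w u(4) by (simp add: of_nat_diff)
  have "l \<in> lines" using Cons.prems(1) by simp
  moreover have "k \<le> e - length ls" using u(4) by simp
  ultimately obtain s v where sv: "v \<in> forms (int (e - length ls) - 1)" "w = s * u + l * v"
    using line_division[OF _ u(2,3) w'] by blast
  have "f = (a + (prod_list ls * s) * u) + prod_list (l # ls) * v"
    unfolding f sv(2) by (simp add: algebra_simps)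
  moreover have "a + (prod_list ls * s) * u \<in> A"
    by (intro module.subspace_add[OF module_times A] ideal_times_mult[OF A] a u(1))
  moreover have "v \<in> forms (int e - int (length (l # ls)))"
    using sv(1) u(4) by (simp add: of_nat_diff algebra_simps)
  ultimately show ?case by blast
qed

text \<open>
  If \<open>h\<close> is not represented for a product of linear forms, then \<open>l h\<close> is not represented for the
  product with one more factor \<open>l\<close>: in a representation of \<open>l h\<close>, the factor \<open>l\<close> divides \<open>a v\<close>, hence \<open>v\<close>,
  and can be cancelled. For a single factor \<open>v\<close> has degree \<open>- 1\<close> and is zero.
\<close>

lemma forms_not_covered:
  fixes a :: "'a::field poly poly"
  assumes "ls \<noteq> []" "set ls \<subseteq> lines" "\<And>l. l \<in> set ls \<Longrightarrow> \<not> l dvd a"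
    and a: "a \<in> forms (int n)" "n \<ge> 1"
  shows "\<exists>h\<in>forms (int n + int (length ls) - 2).
    \<forall>u. \<forall>v\<in>forms (int (length ls) - 2). h \<noteq> prod_list ls * u + a * v"
  using assms(1-3)
proof (induction ls rule: list_nonempty_induct)
  case (single l)
  then obtain h where h: "h \<in> forms (int (n - 1))" "\<not> l dvd h"
    using line_avoiding_form[of l "n - 1"] by auto
  have "h \<noteq> prod_list [l] * u + a * v" if "v \<in> forms (int (length [l]) - 2)" for u v
    using that h(2) by (auto simp: forms_negative)
  moreover have "h \<in> forms (int n + int (length [l]) - 2)"
    using h(1) a(2) by (simp add: of_nat_diff)
  ultimately show ?case by blast
next
  case (cons l ls)
  then obtain h where h: "h \<in> forms (int n + int (length ls) - 2)"
    "\<And>u v. v \<in> forms (int (length ls) - 2) \<Longrightarrow> h \<noteq> prod_list ls * u + a * v"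
    by auto
  have l: "l \<in> lines" "l \<noteq> 0" "\<not> l dvd a"
    using cons.prems by (auto simp: line_nonzero)
  have "l * h \<noteq> prod_list (l # ls) * u + a * v" if v: "v \<in> forms (int (length (l # ls)) - 2)" for u v
  proof
    assume eq: "l * h = prod_list (l # ls) * u + a * v"
    then have "a * v = l * (h - prod_list ls * u)" by (simp add: algebra_simps)
    then have "l dvd a * v" by simp
    then have "l dvd v" using line_prime[OF l(1) a(1) v] l(3) by blast
    then obtain v' where v': "v = l * v'" by blast
    then have "v' \<in> forms (int (length (l # ls)) - 2 - 1)"
      using form_factor[OF lines_forms[OF l(1)] l(2), of v'] v by metis
    then have "v' \<in> forms (int (length ls) - 2)" by (simp add: algebra_simps)
    moreover have "l * h = l * (prod_list ls * u + a * v')"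
      using eq v' by (simp add: algebra_simps)
    then have "h = prod_list ls * u + a * v'" using l(2) by (metis mult_left_cancel)
    ultimately show False using h(2) by blast
  qed
  moreover have "l * h \<in> forms (int n + int (length (l # ls)) - 2)"
    using forms_mult[OF lines_forms[OF l(1)] h(1)] by (simp add: algebra_simps)
  ultimately show ?case by blast
qed

section \<open>Greatest common divisors of forms\<close>

text \<open>
  This expresses that \<open>x\<^sup>E\<close> and \<open>y\<^sup>E\<close> are coprime. Multiplication by \<open>y\<^sup>E\<close> only shifts coefficients, so
  divisibility by \<open>x\<^sup>E\<close> can be read off from them. The divisor \<open>h\<close> may be any polynomial, as required
  for greatest common divisors in the ring.
\<close>

lemma dvd_of_dvd_var_powers:
  fixes h p :: "'a::field poly poly"
  assumes "h dvd p * var_x ^ E" "h dvd p * var_y ^ E"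
  shows "h dvd p"
proof (cases "h = 0")
  case True
  then show ?thesis using assms(1) by (simp add: var_nonzero)
next
  case False
  obtain k k' where k: "p * var_x ^ E = h * k" "p * var_y ^ E = h * k'" using assms by (auto elim!: dvdE)
  have "h * (k * var_y ^ E) = (p * var_x ^ E) * var_y ^ E" by (simp only: k mult.assoc)
  also have "\<dots> = (p * var_y ^ E) * var_x ^ E" by (simp only: ac_simps)
  also have "\<dots> = h * (k' * var_x ^ E)" by (simp only: k mult.assoc)
  finally have eq: "k * var_y ^ E = k' * var_x ^ E" using False by (metis mult_left_cancel)
  have y: "var_y ^ E = monom (1::'a poly) E" by (simp add: var_y_def monom_altdef)
  have x: "var_x ^ E = [:monom (1::'a) E:]"
    unfolding var_x_def by (induction E) (simp_all add: one_pCons monom_Suc monom_0)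
  have "coeff k i = monom 1 E * coeff k' (i + E)" for i
    using arg_cong[OF eq, of "\<lambda>q. coeff q (i + E)"] unfolding x y
    by (simp add: mult.commute[of k] coeff_monom_mult)
  then have "var_x ^ E dvd k" unfolding x const_poly_dvd_iff by simp
  then obtain k'' where "k = var_x ^ E * k''" by blast
  then have "var_x ^ E * p = var_x ^ E * (h * k'')" using k(1) by (simp add: ac_simps)
  then have "p = h * k''" by (simp add: var_nonzero)
  then show ?thesis by simp
qed

lemma dvd_ideal_gen:
  assumes "\<And>u. u \<in> U \<Longrightarrow> h dvd u" "f \<in> ideal_gen U"
  shows "h dvd f"
proof -
  have "module.subspace (*) {f. h dvd f}"
    by (intro module.subspaceI[OF module_times]) auto
  then have "ideal_gen U \<subseteq> {f. h dvd f}"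
    using assms(1) by (intro module.span_minimal[OF module_times]) auto
  then show ?thesis using assms(2) by blast
qed

lemma subspace_ideal_gen: "module.subspace (*) (ideal_gen U)"
  by (rule module.subspace_span[OF module_times])

lemma ideal_gen_base: "u \<in> U \<Longrightarrow> u \<in> ideal_gen U"
  by (rule module.span_base[OF module_times])

text \<open>
  A common divisor \<open>p\<close> of largest degree is taken. No linear form divides all of \<open>U / p\<close>, so by
  peeling the linear factors off one element of \<open>U / p\<close>, the ideal generated by \<open>U / p\<close> is
  seen to contain all forms of large degree. In particular it contains powers of \<open>x\<close> and \<open>y\<close>, which
  makes \<open>p\<close> a greatest common divisor among all polynomials.
\<close>

lemma gcd_of_forms:
  fixes U :: "'a::alg_closed_field poly poly set"
  assumes U: "U \<subseteq> forms (int d)" "u0 \<in> U" "u0 \<noteq> 0"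
  shows "\<exists>p. p \<in> forms (int (gcd_degree U)) \<and> p \<noteq> 0 \<and> is_gcd_of p U \<and>
    (\<exists>E. \<forall>e\<ge>E. \<forall>w\<in>forms (int e). p * w \<in> ideal_gen U)"
proof -
  define Q where "Q s \<longleftrightarrow> (\<exists>p\<in>forms (int s). p \<noteq> 0 \<and> (\<forall>u\<in>U. p dvd u))" for s
  have "Q 0" unfolding Q_def using one_in_forms by (intro bexI[of _ 1]) auto
  moreover have bound: "\<forall>s. Q s \<longrightarrow> s \<le> d"
    using form_dvd_degree[of _ _ u0 "int d"] U by (fastforce simp: Q_def)
  ultimately obtain s where s: "Q s" "\<And>s'. Q s' \<Longrightarrow> s' \<le> s"
    using ex_has_greatest_nat[of Q 0 "\<lambda>s. s" "Suc d"] by (auto simp: less_Suc_eq_le)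
  then obtain p where p: "p \<in> forms (int s)" "p \<noteq> 0" "\<And>u. u \<in> U \<Longrightarrow> p dvd u"
    unfolding Q_def by blast
  have sd: "s \<le> d" using bound s(1) by blast
  have quot: "u \<in> forms (int (d - s))" if "p * u \<in> U" for u
    using form_factor[OF p(1,2), of u "int d"] U(1) that sd by (auto simp: of_nat_diff)
  define A where "A = {w. p * w \<in> ideal_gen U}"
  have A: "module.subspace (*) A"
  proof (rule module.subspaceI[OF module_times])
    show "0 \<in> A" by (simp add: A_def module.span_zero[OF module_times])
    show "x + y \<in> A" if "x \<in> A" "y \<in> A" for x y
      using that by (simp add: A_def distrib_left module.span_add[OF module_times])
    show "c * x \<in> A" if "x \<in> A" for c x
      using that ideal_times_mult[OF subspace_ideal_gen, of "p * x" U c] by (simp add: A_def ac_simps)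
  qed
  have UA: "u \<in> A" if "p * u \<in> U" for u
    using that by (simp add: A_def ideal_gen_base)
  obtain v0 where v0: "u0 = p * v0" using p(3) U(2) by blast
  then have v0': "v0 \<in> forms (int (d - s))" "v0 \<noteq> 0" using quot U by auto
  obtain c ls where ls: "c \<noteq> 0" "length ls = d - s" "set ls \<subseteq> lines" "v0 = scalar c (prod_list ls)"
    using form_factorization[OF v0'] by blast
  have prod: "prod_list ls \<in> A"
  proof -
    have "prod_list ls = [:[:1 / c:]:] * v0"
      using ls(1) unfolding ls(4) by (simp add: scalar_def one_pCons[symmetric])
    also have "\<dots> \<in> A" using UA[of v0] v0 U(2) by (intro ideal_times_mult[OF A]) simp
    finally show ?thesis .
  qed
  \<comment> \<open>Otherwise \<open>p l\<close> would be a common divisor of larger degree.\<close>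
  have avoid: "\<exists>u. p * u \<in> U \<and> \<not> l dvd u" if l: "l \<in> lines" for l
  proof (rule ccontr)
    assume "\<not> ?thesis"
    then have "\<forall>u\<in>U. p * l dvd u" using p(3) by (metis dvdE dvd_refl mult_dvd_mono)
    moreover have "p * l \<in> forms (int (Suc s))"
      using forms_mult[OF p(1) lines_forms[OF l]] by (simp add: add.commute)
    moreover have "p * l \<noteq> 0" using p(2) line_nonzero[OF l] by simp
    ultimately have "Q (Suc s)" unfolding Q_def by blast
    then show False using s(2) by fastforce
  qed
  \<comment> \<open>There are \<open>d - s\<close> linear factors, and the forms avoiding them have degree \<open>d - s\<close>.\<close>
  have cov: "w \<in> A" if e: "e \<ge> 2 * (d - s)" and w: "w \<in> forms (int e)" for e w
  proof -
    have "\<exists>u\<in>A. \<exists>k. u \<in> forms (int k) \<and> \<not> l dvd u \<and> k + length ls \<le> e + 1" if "l \<in> set ls" for l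
    proof -
      obtain u where u: "p * u \<in> U" "\<not> l dvd u" using avoid[of l] ls(3) \<open>l \<in> set ls\<close> by blast
      then show ?thesis using UA quot ls(2) e by (intro bexI[of _ u] exI[of _ "d - s"]) auto
    qed
    then obtain a v where "a \<in> A" "w = a + prod_list ls * v"
      using forms_covered[OF A ls(3) _ w] by blast
    then show ?thesis
      using ideal_times_mult[OF A prod, of v] module.subspace_add[OF module_times A]
      by (simp add: mult.commute)
  qed
  have gcd: "is_gcd_of p U"
    unfolding is_gcd_of_def
  proof (intro conjI ballI allI impI p(3))
    fix h assume h: "\<forall>f\<in>U. h dvd f"
    have "h dvd p * w" if "w \<in> forms (int (2 * (d - s)))" for w
      using cov[OF order.refl that] h dvd_ideal_gen[of U h] by (simp add: A_def)
    then show "h dvd p"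
      using forms_power[OF var_x_forms, of "2 * (d - s)"] forms_power[OF var_y_forms, of "2 * (d - s)"]
      by (intro dvd_of_dvd_var_powers[of h p "2 * (d - s)"]) auto
  qed
  have "gcd_degree U = s"
    unfolding gcd_degree_def
  proof (rule the_equality)
    show "\<exists>g. g \<noteq> 0 \<and> is_gcd_of g U \<and> g \<in> forms (int s)" using p gcd by blast
    fix e assume "\<exists>g. g \<noteq> 0 \<and> is_gcd_of g U \<and> g \<in> forms (int e)"
    then obtain g where g: "g \<noteq> 0" "is_gcd_of g U" "g \<in> forms (int e)" by blast
    then have "p dvd g" "g dvd p" using gcd by (auto simp: is_gcd_of_def)
    then show "e = s"
      using form_dvd_degree[OF p(1) g(3,1)] form_dvd_degree[OF g(3) p(1,2)] by simp
  qed
  moreover have "\<forall>e\<ge>2 * (d - s). \<forall>w\<in>forms (int e). p * w \<in> ideal_gen U"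
    using cov by (simp add: A_def)
  ultimately show ?thesis using p(1,2) gcd by blast
qed

section \<open>Spanning modulo a subspace\<close>

text \<open>
  The Steinitz exchange step in the quotient by \<open>span S\<close>; working with \<open>span (S \<union> B)\<close> avoids forming the
  quotient space.
\<close>

lemma (in vector_space) span_exchange:
  assumes "finite B" "x \<in> span (S \<union> B)" "x \<notin> span S"
  shows "\<exists>b\<in>B. span (S \<union> B) \<subseteq> span (insert x (S \<union> (B - {b})))"
  using assms
proof (induction B rule: finite_induct)
  case (insert b B)
  show ?case
  proof (cases "x \<in> span (S \<union> B)")
    case True
    then obtain b' where b': "b' \<in> B" "span (S \<union> B) \<subseteq> span (insert x (S \<union> (B - {b'})))"
      using insert by blast
    let ?T = "insert x (S \<union> (insert b B - {b'}))"
    have "span (insert x (S \<union> (B - {b'}))) \<subseteq> span ?T" by (rule span_mono) blast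
    then have "S \<union> B \<subseteq> span ?T" using b'(2) span_superset[of "S \<union> B"] by blast
    moreover have "b \<in> span ?T" using b' insert.hyps by (intro span_base) auto
    ultimately have "S \<union> insert b B \<subseteq> span ?T" by blast
    then have "span (S \<union> insert b B) \<subseteq> span ?T" by (simp add: span_minimal)
    then show ?thesis using b'(1) by blast
  next
    case False
    then have "b \<in> span (insert x (S \<union> B))"
      using insert.prems(1) in_span_insert[of x b "S \<union> B"] by simp
    moreover have "S \<union> B \<subseteq> span (insert x (S \<union> B))" using span_superset[of "insert x (S \<union> B)"] by simp
    ultimately have "S \<union> insert b B \<subseteq> span (insert x (S \<union> B))" by blast
    then have "span (S \<union> insert b B) \<subseteq> span (insert x (S \<union> B))" by (simp add: span_minimal)
    moreover have "insert b B - {b} = B" using insert.hyps by auto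
    ultimately show ?thesis by (intro bexI[of _ b]) auto
  qed
qed auto

text \<open>
  If no \<open>e i\<close> depended on its predecessors, they could be exchanged one after the other for the
  elements of \<open>B\<close>, and the last one would be left over.
\<close>

lemma (in vector_space) dependent_modulo:
  fixes e :: "nat \<Rightarrow> 'b"
  assumes "finite B" "card B \<le> m" "\<And>i. i \<le> m \<Longrightarrow> e i \<in> span (S \<union> B)"
  shows "\<exists>i\<le>m. e i \<in> span (S \<union> e ` {..<i})"
proof (rule ccontr)
  assume indep: "\<not> ?thesis"
  have "\<exists>C. finite C \<and> card C + k \<le> card B \<and> span (S \<union> B) \<subseteq> span (S \<union> e ` {..<k} \<union> C)"
    if "k \<le> Suc m" for k
    using that
  proof (induction k)
    case 0
    then show ?case using assms(1) by (intro exI[of _ B]) auto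
  next
    case (Suc k)
    then obtain C where C: "finite C" "card C + k \<le> card B"
      "span (S \<union> B) \<subseteq> span (S \<union> e ` {..<k} \<union> C)" by auto
    have "e k \<in> span (S \<union> e ` {..<k} \<union> C)" using C(3) assms(3)[of k] Suc.prems by auto
    moreover have "e k \<notin> span (S \<union> e ` {..<k})" using indep Suc.prems by auto
    ultimately obtain b where b: "b \<in> C"
      "span (S \<union> e ` {..<k} \<union> C) \<subseteq> span (insert (e k) (S \<union> e ` {..<k} \<union> (C - {b})))"
      using span_exchange[OF C(1)] by blast
    have "insert (e k) (S \<union> e ` {..<k} \<union> (C - {b})) = S \<union> e ` {..<Suc k} \<union> (C - {b})"
      by (auto simp: lessThan_Suc)
    then have "span (S \<union> B) \<subseteq> span (S \<union> e ` {..<Suc k} \<union> (C - {b}))" using C(3) b(2) by simp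
    moreover have "card (C - {b}) + Suc k \<le> card B"
      using C(1,2) b(1) card_Suc_Diff1[of C b] by simp
    ultimately show ?case using C(1) by blast
  qed
  from this[of "Suc m"] show False using assms(2) by auto
qed

text \<open>
  The number of generators of \<open>N t\<close> modulo \<open>W t\<close> does not increase under an eventually surjective
  multiplication, so it is eventually constant. A form killed by the multiplication could be made
  one of a minimal set of generators, and dropping its image would lower the number.
\<close>

lemma eventually_injective:
  fixes W N :: "nat \<Rightarrow> 'a::field poly poly set"
  assumes W: "\<And>t. form_subspace (W t)"
    and fin: "\<And>t. \<exists>B. finite B \<and> N t \<subseteq> vs.span B"
    and fW: "\<And>t h. h \<in> W t \<Longrightarrow> f * h \<in> W (Suc t)"
    and surj: "\<And>t h. t \<ge> T \<Longrightarrow> h \<in> N (Suc t) \<Longrightarrow> \<exists>h'\<in>N t. h - f * h' \<in> W (Suc t)"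
  shows "\<exists>T' m. (\<forall>t\<ge>T'. \<forall>h\<in>N t. f * h \<in> W (Suc t) \<longrightarrow> h \<in> W t) \<and>
    (\<forall>t\<ge>T'. \<exists>B. finite B \<and> card B \<le> m \<and> N t \<subseteq> vs.span (W t \<union> B))"
proof -
  define gens where "gens t B \<longleftrightarrow> finite B \<and> N t \<subseteq> vs.span (W t \<union> B)" for t B
  define q where "q t = (LEAST n. \<exists>B. gens t B \<and> card B = n)" for t
  have image: "f * x \<in> vs.span (W (Suc t) \<union> (*) f ` B)" if x: "x \<in> vs.span (W t \<union> B)" for x t B
  proof -
    let ?S = "vs.span (W (Suc t) \<union> (*) f ` B)"
    have "form_subspace {x. f * x \<in> ?S}"
    proof (rule vs.subspaceI)
      show "0 \<in> {x. f * x \<in> ?S}" by (simp add: vs.span_zero)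
      show "x + y \<in> {x. f * x \<in> ?S}" if "x \<in> {x. f * x \<in> ?S}" "y \<in> {x. f * x \<in> ?S}" for x y
        using that by (simp add: distrib_left vs.span_add)
      show "scalar c x \<in> {x. f * x \<in> ?S}" if "x \<in> {x. f * x \<in> ?S}" for c x
        using that vs.span_scale[of "f * x" _ c] by (simp add: scalar_def)
    qed
    moreover have "W t \<union> B \<subseteq> {x. f * x \<in> ?S}" using fW by (auto intro: vs.span_base)
    ultimately show ?thesis using vs.span_minimal x by blast
  qed
  have gens_step: "gens (Suc t) C"
    if "gens t B" "t \<ge> T" "finite C" "vs.span (W (Suc t) \<union> (*) f ` B) \<subseteq> vs.span (W (Suc t) \<union> C)" for t B C
  proof -
    have "h \<in> vs.span (W (Suc t) \<union> C)" if "h \<in> N (Suc t)" for h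
    proof -
      obtain h' where h': "h' \<in> N t" "h - f * h' \<in> W (Suc t)"
        using surj[of t h] \<open>t \<ge> T\<close> \<open>h \<in> N (Suc t)\<close> by blast
      have "h' \<in> vs.span (W t \<union> B)" using \<open>gens t B\<close> h'(1) unfolding gens_def by blast
      then have "f * h' \<in> vs.span (W (Suc t) \<union> C)" using image \<open>_ \<subseteq> vs.span (W (Suc t) \<union> C)\<close> by blast
      moreover have "h - f * h' \<in> vs.span (W (Suc t) \<union> C)" using h'(2) by (intro vs.span_base) auto
      ultimately show ?thesis using vs.span_add by fastforce
    qed
    then show ?thesis using \<open>finite C\<close> by (auto simp: gens_def)
  qed
  have ex: "\<exists>n B. gens t B \<and> card B = n" for t
    using fin[of t] vs.span_mono[of _ "W t \<union> _"] unfolding gens_def by (meson Un_upper2 order_trans)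
  have q_attained: "\<exists>B. gens t B \<and> card B = q t" for t
    using LeastI_ex[OF ex] unfolding q_def .
  have q_le: "q t \<le> card B" if "gens t B" for t B
    unfolding q_def using that by (intro Least_le) blast
  have q_Suc: "q (Suc t) \<le> q t" if t: "t \<ge> T" for t
  proof -
    obtain B where B: "gens t B" "card B = q t" using q_attained by blast
    then have "gens (Suc t) ((*) f ` B)" using gens_step[OF B(1) t, of "(*) f ` B"] by (auto simp: gens_def)
    then have "q (Suc t) \<le> card ((*) f ` B)" by (rule q_le)
    also have "\<dots> \<le> q t" using B by (metis card_image_le gens_def)
    finally show ?thesis .
  qed
  obtain T' where T': "T' \<ge> T" "\<And>t. t \<ge> T \<Longrightarrow> q T' \<le> q t"
    using ex_has_least_nat[of "\<lambda>t. t \<ge> T" T q] by blast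
  have const: "q t = q T'" if "t \<ge> T'" for t
    using that
  proof (induction t rule: dec_induct)
    case (step t)
    then show ?case using q_Suc[of t] T' by (intro antisym) auto
  qed simp
  have "h \<in> W t" if t: "t \<ge> T'" and h: "h \<in> N t" "f * h \<in> W (Suc t)" for t h
  proof (rule ccontr)
    assume "h \<notin> W t"
    obtain B where B: "gens t B" "card B = q t" using q_attained by blast
    have "h \<in> vs.span (W t \<union> B)" using B(1) h(1) by (auto simp: gens_def)
    moreover have "h \<notin> vs.span (W t)" using \<open>h \<notin> W t\<close> W by (metis vs.span_eq_iff)
    moreover have finB: "finite B" using B(1) by (simp add: gens_def)
    ultimately obtain b where b: "b \<in> B"
      "vs.span (W t \<union> B) \<subseteq> vs.span (insert h (W t \<union> (B - {b})))"
      using vs.span_exchange by blast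
    let ?B = "insert h (B - {b})"
    have "gens t ?B" using B(1) b(2) finB by (auto simp: gens_def)
    moreover have "vs.span (W (Suc t) \<union> (*) f ` ?B) \<subseteq> vs.span (W (Suc t) \<union> (*) f ` (B - {b}))"
      using h(2) by (intro vs.span_minimal) (auto intro: vs.span_base)
    ultimately have "gens (Suc t) ((*) f ` (B - {b}))"
      using t T'(1) finB by (intro gens_step[of t ?B]) auto
    then have "q (Suc t) \<le> card ((*) f ` (B - {b}))" by (rule q_le)
    also have "\<dots> \<le> card (B - {b})" using finB by (intro card_image_le) auto
    also have "\<dots> < q t" using B(2) b(1) finB by (metis card_Diff1_less)
    finally show False using const[of t] const[of "Suc t"] t by simp
  qed
  moreover have "\<exists>B. finite B \<and> card B \<le> q T' \<and> N t \<subseteq> vs.span (W t \<union> B)" if "t \<ge> T'" for t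
    using q_attained[of t] const[OF that] by (auto simp: gens_def)
  ultimately show ?thesis by blast
qed

lemma prod_list_maps:
  fixes N :: "nat \<Rightarrow> 'a::comm_ring_1 set"
  assumes "\<And>l t h. l \<in> set ls \<Longrightarrow> h \<in> N t \<Longrightarrow> l * h \<in> N (Suc t)" "h \<in> N t"
  shows "prod_list ls * h \<in> N (t + length ls)"
  using assms by (induction ls) (simp_all add: mult.assoc)

lemma prod_list_injective:
  fixes W N :: "nat \<Rightarrow> 'a::comm_ring_1 set"
  assumes "\<And>l t h. l \<in> set ls \<Longrightarrow> t \<ge> T \<Longrightarrow> h \<in> N t \<Longrightarrow> l * h \<in> W (Suc t) \<Longrightarrow> h \<in> W t"
    and "\<And>l t h. l \<in> set ls \<Longrightarrow> h \<in> N t \<Longrightarrow> l * h \<in> N (Suc t)"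
    and "t \<ge> T" "h \<in> N t" "prod_list ls * h \<in> W (t + length ls)"
  shows "h \<in> W t"
  using assms
proof (induction ls)
  case (Cons l ls)
  have "prod_list ls * h \<in> N (t + length ls)"
    using Cons.prems(2,4) by (intro prod_list_maps) auto
  then have "prod_list ls * h \<in> W (t + length ls)"
    using Cons.prems(1)[of l "t + length ls" "prod_list ls * h"] Cons.prems(3,5)
    by (simp add: mult.assoc)
  moreover have "h' \<in> W t'" if "l' \<in> set ls" "t' \<ge> T" "h' \<in> N t'" "l' * h' \<in> W (Suc t')" for l' t' h'
    using Cons.prems(1)[of l' t' h'] that by simp
  moreover have "l' * h' \<in> N (Suc t')" if "l' \<in> set ls" "h' \<in> N t'" for l' t' h'
    using Cons.prems(2)[of l' h' t'] that by simp
  ultimately show ?case using Cons.IH Cons.prems(3,4) by blast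
qed simp

text \<open>
  If all members of a pencil are eventually surjective on \<open>N t / W t\<close>, the quotients vanish. The
  products \<open>g\<^sup>i f\<^sup>m\<^sup>-\<^sup>i h\<close> are linearly dependent modulo \<open>W\<close> for \<open>m\<close> beyond the number of generators, and
  over an algebraically closed field this binary form in \<open>f, g\<close> is a product of members of the
  pencil. These are also eventually injective, so \<open>h\<close> lies in \<open>W\<close>.
\<close>

lemma pencil_quotient_vanishes:
  fixes W N :: "nat \<Rightarrow> 'a::alg_closed_field poly poly set"
  defines "L f g \<equiv> insert f (range (\<lambda>s. g - scalar s f))"
  assumes W: "\<And>t. form_subspace (W t)"
    and fin: "\<And>t. \<exists>B. finite B \<and> N t \<subseteq> vs.span B"
    and LW: "\<And>l t h. l \<in> L f g \<Longrightarrow> h \<in> W t \<Longrightarrow> l * h \<in> W (Suc t)"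
    and LN: "\<And>l t h. l \<in> L f g \<Longrightarrow> h \<in> N t \<Longrightarrow> l * h \<in> N (Suc t)"
    and surj: "\<And>l. l \<in> L f g \<Longrightarrow> \<exists>T. \<forall>t\<ge>T. \<forall>h\<in>N (Suc t). \<exists>h'\<in>N t. h - l * h' \<in> W (Suc t)"
  shows "\<exists>T. \<forall>t\<ge>T. N t \<subseteq> W t"
proof -
  have "\<exists>T m. (\<forall>t\<ge>T. \<forall>h\<in>N t. l * h \<in> W (Suc t) \<longrightarrow> h \<in> W t) \<and>
    (\<forall>t\<ge>T. \<exists>B. finite B \<and> card B \<le> m \<and> N t \<subseteq> vs.span (W t \<union> B))" if l: "l \<in> L f g" for l
  proof -
    obtain T where "\<forall>t\<ge>T. \<forall>h\<in>N (Suc t). \<exists>h'\<in>N t. h - l * h' \<in> W (Suc t)" using surj[OF l] by blast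
    then show ?thesis
      using LW[OF l] by (intro eventually_injective[where W = W and N = N and f = l] W fin) auto
  qed
  then obtain T m where inj: "\<And>l t h. l \<in> L f g \<Longrightarrow> t \<ge> T l \<Longrightarrow> h \<in> N t \<Longrightarrow> l * h \<in> W (Suc t) \<Longrightarrow> h \<in> W t"
    and bound: "\<And>l t. l \<in> L f g \<Longrightarrow> t \<ge> T l \<Longrightarrow> \<exists>B. finite B \<and> card B \<le> m l \<and> N t \<subseteq> vs.span (W t \<union> B)"
    by metis
  have f: "f \<in> L f g" by (simp add: L_def)
  have g: "g \<in> L f g" unfolding L_def by (rule insertI2, rule range_eqI[of _ _ 0]) simp
  let ?m = "m f"
  have "h \<in> W t" if t: "t \<ge> T f" and h: "h \<in> N t" for t h
  proof -
    have powers: "l ^ i * x \<in> N (t + i)" if "l \<in> L f g" "x \<in> N t" for l i x t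
      using that LN by (induction i) (simp_all add: mult.assoc)
    have powersW: "l ^ i * x \<in> W (t + i)" if "l \<in> L f g" "x \<in> W t" for l i x t
      using that LW by (induction i) (simp_all add: mult.assoc)
    define e where "e i = g ^ i * f ^ (?m - i) * h" for i
    have eN: "e i \<in> N (t + ?m)" if "i \<le> ?m" for i
      using powers[OF g powers[OF f h, of "?m - i"], of i] that by (simp add: e_def mult.assoc)
    obtain B where B: "finite B" "card B \<le> ?m" "N (t + ?m) \<subseteq> vs.span (W (t + ?m) \<union> B)"
      using bound[OF f, of "t + ?m"] t by auto
    then obtain i where i: "i \<le> ?m" "e i \<in> vs.span (W (t + ?m) \<union> e ` {..<i})"
      using vs.dependent_modulo[of B ?m e "W (t + ?m)"] eN by blast
    moreover have "vs.span (W (t + ?m)) = W (t + ?m)" using W vs.span_eq_iff by blast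
    ultimately obtain w y where wy: "w \<in> W (t + ?m)" "y \<in> vs.span (e ` {..<i})" "e i = w + y"
      unfolding vs.span_Un by auto
    then obtain c where c: "y = (\<Sum>j<i. scalar (c j) (e j))" using vs.span_indexed by blast
    \<comment> \<open>The dependence as a polynomial, nonzero because its coefficient at \<open>i\<close> is \<open>1\<close>.\<close>
    define P where "P = monom 1 i - (\<Sum>j<i. monom (c j) j)"
    have coeffP: "coeff P j = (if j = i then 1 else if j < i then - c j else 0)" for j
      by (simp add: P_def coeff_sum coeff_monom)
    have "P \<noteq> 0" using coeffP[of i] by auto
    moreover have "degree P \<le> ?m" using coeffP i(1) by (intro degree_le) auto
    ultimately obtain a ls where ls: "a \<noteq> 0" "length ls = ?m" "set ls \<subseteq> L f g"
      "(\<Sum>j\<le>?m. scalar (coeff P j) (g ^ j * f ^ (?m - j))) = scalar a (prod_list ls)"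
      unfolding L_def using binary_factorization by blast
    have "scalar a (prod_list ls * h) = (\<Sum>j\<le>?m. scalar (coeff P j) (e j))"
      using arg_cong[OF ls(4), of "\<lambda>x. x * h"] by (simp add: sum_distrib_right scalar_def e_def)
    also have "\<dots> = (\<Sum>j\<in>{..i}. scalar (coeff P j) (e j))"
      using i(1) by (intro sum.mono_neutral_right) (auto simp: coeffP)
    also have "\<dots> = e i - y"
      unfolding c by (simp add: lessThan_Suc_atMost[symmetric] coeffP sum_negf)
    also have "\<dots> = w" using wy(3) by simp
    finally have "scalar (1 / a) (scalar a (prod_list ls * h)) \<in> W (t + ?m)"
      using wy(1) vs.subspace_scale[OF W] by simp
    then have in_W: "prod_list ls * h \<in> W (t + length ls)" using ls(1,2) by simp
    \<comment> \<open>The factors are injective only in large degree, so \<open>h\<close> is first multiplied by a power of \<open>f\<close>.\<close>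
    define k where "k = (\<Sum>l\<in>set ls. T l)"
    have k: "k \<ge> T l" if "l \<in> set ls" for l
      unfolding k_def using that by (intro member_le_sum) auto
    have "f ^ k * h \<in> W (t + k)"
    proof (rule prod_list_injective[where T = "t + k" and N = N, rotated 2])
      show "f ^ k * h \<in> N (t + k)" by (rule powers[OF f h])
      show "h' \<in> W t'" if "l \<in> set ls" "t' \<ge> t + k" "h' \<in> N t'" "l * h' \<in> W (Suc t')" for l t' h'
        using inj[of l t' h'] k[of l] ls(3) that by auto
      show "l * h' \<in> N (Suc t')" if "l \<in> set ls" "h' \<in> N t'" for l t' h'
        using LN[of l h' t'] ls(3) that by auto
      show "prod_list ls * (f ^ k * h) \<in> W (t + k + length ls)"
        using powersW[OF f in_W, of k] by (simp add: ac_simps)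
    qed simp
    then show "h \<in> W t"
    proof (induction k)
      case (Suc k)
      then show ?case using inj[OF f, of "t + k" "f ^ k * h"] powers[OF f h, of k] t
        by (simp add: mult.assoc)
    qed simp
  qed
  then show ?thesis by blast
qed

section \<open>Powers of a homogeneous ideal\<close>

lemma form_subspace_ideal:
  assumes "module.subspace (*) (A :: 'a::field poly poly set)"
  shows "form_subspace A"
  using module.subspace_0[OF module_times assms] module.subspace_add[OF module_times assms]
    ideal_times_mult[OF assms]
  by (intro vs.subspaceI) (simp_all only: scalar_eq_mult)

lemma span_scalar_subset_ideal_gen: "vs.span U \<subseteq> ideal_gen U"
  by (intro vs.span_minimal form_subspace_ideal subspace_ideal_gen) (auto intro: ideal_gen_base)

lemma ideal_gen_minimal:
  "module.subspace (*) A \<Longrightarrow> U \<subseteq> A \<Longrightarrow> ideal_gen U \<subseteq> A"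
  by (rule module.span_minimal[OF module_times])

lemma hcomp_mult:
  "\<exists>A. finite A \<and> (\<forall>e. hcomp e (c * f) = (\<Sum>k\<in>A. hcomp (e - k) c * hcomp k f))"
proof -
  obtain A where A: "finite A" "f = (\<Sum>k\<in>A. hcomp k f)" using sum_hcomp by blast
  have "hcomp e (c * f) = (\<Sum>k\<in>A. hcomp (e - k) c * hcomp k f)" for e
  proof -
    have "hcomp e (c * f) = hcomp e (c * (\<Sum>k\<in>A. hcomp k f))" by (simp flip: A(2))
    then show ?thesis
      by (simp add: sum_distrib_left hcomp_sum hcomp_mult_form[OF hcomp_in_forms])
  qed
  then show ?thesis using A(1) by blast
qed

lemma ideal_gen_homogeneous:
  fixes U :: "'a::field poly poly set"
  assumes U: "\<And>u e. u \<in> U \<Longrightarrow> hcomp e u \<in> ideal_gen U" and f: "f \<in> ideal_gen U"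
  shows "hcomp e f \<in> ideal_gen U"
proof -
  let ?H = "{f. \<forall>e. hcomp e f \<in> ideal_gen U}"
  have "module.subspace (*) ?H"
  proof (rule module.subspaceI[OF module_times])
    show "0 \<in> ?H" by (simp add: module.span_zero[OF module_times])
    show "x + y \<in> ?H" if "x \<in> ?H" "y \<in> ?H" for x y
      using that by (simp add: hcomp_add module.span_add[OF module_times])
    show "c * x \<in> ?H" if x: "x \<in> ?H" for c x
    proof -
      obtain A where A: "\<And>e. hcomp e (c * x) = (\<Sum>k\<in>A. hcomp (e - k) c * hcomp k x)"
        using hcomp_mult[of c x] by blast
      have "hcomp k x \<in> ideal_gen U" for k using x by simp
      then show ?thesis
        unfolding mem_Collect_eq A
        by (intro allI module.span_sum[OF module_times] module.span_scale[OF module_times])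
    qed
  qed
  then have "ideal_gen U \<subseteq> ?H" using U by (intro ideal_gen_minimal) auto
  then show ?thesis using f by blast
qed

lemma hcomp_generators: "U \<subseteq> forms d \<Longrightarrow> u \<in> U \<Longrightarrow> hcomp e u \<in> ideal_gen U"
  using hcomp_form[of u d e] ideal_gen_base[of u U] module.span_zero[OF module_times, of U]
  by (cases "e = d") auto

lemma subspace_ideal_power: "module.subspace (*) (ideal_power I t)"
  by (cases t) (simp_all add: module.subspace_UNIV[OF module_times] subspace_ideal_gen)

lemma ideal_power_mult: "f \<in> I \<Longrightarrow> g \<in> ideal_power I t \<Longrightarrow> f * g \<in> ideal_power I (Suc t)"
  by (auto intro!: ideal_gen_base)

lemma ideal_power_power: "f \<in> I \<Longrightarrow> f ^ t \<in> ideal_power I t"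
proof (induction t)
  case (Suc t)
  then show ?case using ideal_power_mult[of f I "f ^ t" t] by simp
qed simp

lemma ideal_power_homogeneous:
  fixes I :: "'a::field poly poly set"
  assumes I: "\<And>f e. f \<in> I \<Longrightarrow> hcomp e f \<in> I" and f: "f \<in> ideal_power I t"
  shows "hcomp e f \<in> ideal_power I t"
  using f
proof (induction t arbitrary: f e)
  case (Suc t)
  show ?case
  proof (simp only: ideal_power.simps, rule ideal_gen_homogeneous)
    fix u e assume "u \<in> {f * g | f g. f \<in> I \<and> g \<in> ideal_power I t}"
    then obtain f g where fg: "u = f * g" "f \<in> I" "g \<in> ideal_power I t" by blast
    obtain A where A: "\<And>e. hcomp e (f * g) = (\<Sum>k\<in>A. hcomp (e - k) f * hcomp k g)"
      using hcomp_mult[of f g] by blast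
    show "hcomp e u \<in> ideal_gen {f * g | f g. f \<in> I \<and> g \<in> ideal_power I t}"
      unfolding fg(1) A
      by (intro module.span_sum[OF module_times] ideal_gen_base) (use I fg Suc.IH in blast)
  qed (use Suc.prems in simp)
qed simp

text \<open>
  Modulo \<open>p\<close> the ideal \<open>I\<close> is contained in \<open>(f)\<close>, so its powers are contained in \<open>(f\<^sup>t)\<close>.
\<close>

lemma ideal_power_subset:
  assumes I: "\<And>h. h \<in> I \<Longrightarrow> \<exists>u v. h = p * u + f * v"
    and "h \<in> ideal_power I t"
  shows "\<exists>u v. h = p * u + f ^ t * (v :: 'a::comm_ring_1)"
  using assms(2)
proof (induction t arbitrary: h)
  case 0
  show ?case by (intro exI[of _ 0] exI[of _ h]) simp
next
  case (Suc t)
  let ?A = "{h. \<exists>u v. h = p * u + f ^ Suc t * v}"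
  have "module.subspace (*) ?A"
  proof (rule module.subspaceI[OF module_times])
    show "0 \<in> ?A" by (auto intro!: exI[of _ 0])
    show "x + y \<in> ?A" if xy: "x \<in> ?A" "y \<in> ?A" for x y
    proof -
      obtain u v u' v' where "x = p * u + f ^ Suc t * v" "y = p * u' + f ^ Suc t * v'" using xy by blast
      then have "x + y = p * (u + u') + f ^ Suc t * (v + v')" by (simp add: algebra_simps)
      then show ?thesis by blast
    qed
    show "c * x \<in> ?A" if x: "x \<in> ?A" for c x
    proof -
      obtain u v where "x = p * u + f ^ Suc t * v" using x by blast
      then have "c * x = p * (c * u) + f ^ Suc t * (c * v)" by (simp add: algebra_simps)
      then show ?thesis by blast
    qed
  qed
  moreover have "a * b \<in> ?A" if ab: "a \<in> I" "b \<in> ideal_power I t" for a b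
  proof -
    obtain u v u' v' where "a = p * u + f * v" "b = p * u' + f ^ t * v'"
      using I[OF ab(1)] Suc.IH[OF ab(2)] by blast
    then have "a * b = p * (u * b + f * v * u') + f ^ Suc t * (v * v')" by (simp add: algebra_simps)
    then show ?thesis by blast
  qed
  ultimately have "ideal_power I (Suc t) \<subseteq> ?A"
    by (simp only: ideal_power.simps) (intro ideal_gen_minimal, blast+)
  then show ?case using Suc.prems by blast
qed

section \<open>Hyperplanes of a space of forms\<close>

text \<open>
  A basis of \<open>U\<close> is finite, being independent in the space of forms of one degree, and extends to a
  basis of \<open>V\<close>.
\<close>

lemma hyperplane_iff:
  fixes U V :: "'a::field poly poly set"
  assumes U: "form_subspace U" and V: "form_subspace V" "V \<subseteq> forms e" and UV: "U \<subseteq> V"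
  shows "form_dim V = form_dim U + 1 \<longleftrightarrow> (\<exists>f\<in>V. f \<notin> U \<and> V \<subseteq> vs.span (insert f U))"
proof -
  obtain T where T: "finite T" "V \<subseteq> vs.span T" using form_subspace_finitely_spanned[OF V] by blast
  obtain B where B: "B \<subseteq> U" "vs.independent B" "U \<subseteq> vs.span B" "card B = form_dim U"
    using vs.basis_exists by blast
  have finite: "finite C" if "vs.independent C" "C \<subseteq> V" for C
    using vs.independent_span_bound[OF T(1) that(1)] that(2) T(2) by blast
  have BU: "vs.span B = U" using B U by (intro vs.span_subspace)
  show ?thesis
  proof
    assume dim: "form_dim V = form_dim U + 1"
    obtain C where C: "B \<subseteq> C" "C \<subseteq> V" "vs.independent C" "V \<subseteq> vs.span C"
      using vs.maximal_independent_subset_extend[of B V] B UV by blast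
    have "card C = card B + 1" using dim vs.basis_card_eq_dim[OF C(2,4,3)] B(4) by simp
    moreover have "finite C" using finite C by blast
    ultimately have "card (C - B) = 1" using C(1) by (simp add: card_Diff_subset finite_subset)
    then obtain f where f: "C - B = {f}" by (auto simp: card_1_singleton_iff)
    then have C': "C = insert f B" "f \<notin> B" using C(1) by auto
    then have "f \<notin> U" using C(3) BU vs.independent_insert[of f B] by auto
    moreover have "V \<subseteq> vs.span (insert f U)"
      using C(4) vs.span_mono[of C "insert f U"] C'(1) B(1) by blast
    ultimately show "\<exists>f\<in>V. f \<notin> U \<and> V \<subseteq> vs.span (insert f U)" using C(2) C'(1) by blast
  next
    assume "\<exists>f\<in>V. f \<notin> U \<and> V \<subseteq> vs.span (insert f U)"
    then obtain f where f: "f \<in> V" "f \<notin> U" "V \<subseteq> vs.span (insert f U)" by blast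
    have "vs.independent (insert f B)" using f(2) BU B(2) by (intro vs.independent_insertI) auto
    moreover have "vs.span (insert f U) \<subseteq> vs.span (insert f B)"
      using BU vs.span_mono[of B "insert f B"] by (intro vs.span_minimal) (auto intro: vs.span_base)
    moreover have "insert f B \<subseteq> V" using f(1) B(1) UV by blast
    ultimately have "card (insert f B) = form_dim V"
      using f(3) by (intro vs.basis_card_eq_dim) auto
    moreover have "f \<notin> B" using f(2) B(1) by blast
    moreover have "finite B" using finite[OF B(2)] B(1) UV by blast
    ultimately show "form_dim V = form_dim U + 1" using B(4) by simp
  qed
qed

locale base_point_free =
  fixes V :: "'a::alg_closed_field poly poly set" and d :: nat
  assumes degree_pos: "d \<ge> 1" and subspace: "form_subspace V" and forms: "V \<subseteq> forms (int d)"
    and coprime: "is_gcd_of 1 V"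
begin

definition hyperplane :: "'a poly poly set \<Rightarrow> bool" where
  "hyperplane U \<longleftrightarrow> form_subspace U \<and> U \<subseteq> V \<and> (\<exists>f\<in>V. f \<notin> U \<and> V \<subseteq> vs.span (insert f U))"

lemma hyperplane_dim:
  "hyperplane U \<longleftrightarrow> form_subspace U \<and> U \<subseteq> V \<and> form_dim V = form_dim U + 1"
  using hyperplane_iff[OF _ subspace forms] by (auto simp: hyperplane_def)

lemma common_divisor_unit: "(\<And>v. v \<in> V \<Longrightarrow> h dvd v) \<Longrightarrow> h dvd 1"
  using coprime by (auto simp: is_gcd_of_def)

lemma dvd_span_insert:
  assumes "\<And>u. u \<in> U \<Longrightarrow> h dvd u" "h dvd f" "V \<subseteq> vs.span (insert f U)"
  shows "h dvd 1"
proof (rule common_divisor_unit)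
  fix v assume "v \<in> V"
  then have "v \<in> ideal_gen (insert f U)" using assms(3) span_scalar_subset_ideal_gen by blast
  then show "h dvd v" by (rule dvd_ideal_gen[rotated]) (use assms in auto)
qed

text \<open>
  If \<open>V\<close> were spanned by one form, this form of positive degree would be a common divisor.
\<close>

lemma hyperplane_nonzero:
  assumes "hyperplane U"
  shows "\<exists>u\<in>U. u \<noteq> 0"
proof (rule ccontr)
  assume zero: "\<not> ?thesis"
  obtain f where f: "f \<in> V" "f \<notin> U" "V \<subseteq> vs.span (insert f U)" using assms by (auto simp: hyperplane_def)
  have "f dvd 1" using zero f(3) by (intro dvd_span_insert[of U f f]) auto
  then have "int d \<le> 0"
    using form_dvd_degree[of f "int d" 1 0] f(1) forms one_in_forms by auto
  then show False using degree_pos by simp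
qed

lemma hyperplane_gcd:
  assumes "hyperplane U"
  shows "\<exists>p. p \<in> forms (int (gcd_degree U)) \<and> p \<noteq> 0 \<and> is_gcd_of p U \<and>
    (\<exists>E. \<forall>e\<ge>E. \<forall>w\<in>forms (int e). p * w \<in> ideal_gen U)"
proof -
  obtain u where "u \<in> U" "u \<noteq> 0" using hyperplane_nonzero[OF assms] by blast
  moreover have "U \<subseteq> forms (int d)" using assms forms by (auto simp: hyperplane_def)
  ultimately show ?thesis by (rule gcd_of_forms[rotated])
qed

lemma gcd_degree_hyperplane_le:
  assumes "hyperplane U"
  shows "gcd_degree U \<le> d"
proof -
  obtain p where "p \<in> forms (int (gcd_degree U))" "is_gcd_of p U" using hyperplane_gcd[OF assms] by blast
  moreover obtain u where "u \<in> U" "u \<noteq> 0" "u \<in> forms (int d)"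
    using hyperplane_nonzero[OF assms] assms forms by (auto simp: hyperplane_def)
  ultimately show ?thesis
    using form_dvd_degree[of p "int (gcd_degree U)" u "int d"] by (auto simp: is_gcd_of_def)
qed

text \<open>The forms of \<open>V\<close> vanishing at a point are a hyperplane with a nontrivial common divisor.\<close>

lemma hyperplane_gcd_degree_pos: "\<exists>U. hyperplane U \<and> gcd_degree U \<ge> 1"
proof -
  have y: "var_y \<in> (lines :: 'a poly poly set)" by (simp add: lines_def)
  let ?U = "{v \<in> V. var_y dvd v}"
  obtain f where f: "f \<in> V" "\<not> var_y dvd f" using common_divisor_unit line_not_unit[OF y] by blast
  have "form_subspace {v :: 'a poly poly. var_y dvd v}"
    by (intro form_subspace_ideal module.subspaceI[OF module_times]) auto
  then have sub: "form_subspace (V \<inter> {v. var_y dvd v})" using subspace by (intro vs.subspace_inter)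
  have "v \<in> vs.span (insert f ?U)" if v: "v \<in> V" for v
  proof -
    obtain s w where s: "s \<in> forms 0" "v = s * f + var_y * w"
      using line_division[OF y _ f(2), of d v d] v f(1) forms by auto
    let ?c = "const_coeff s"
    have "v - scalar ?c f = var_y * w"
      using s(2) forms_0_const[OF s(1)] by (metis add_diff_cancel_left' scalar_eq_mult)
    moreover have "v - scalar ?c f \<in> V" using v f(1) subspace by (intro vs.subspace_diff vs.subspace_scale)
    ultimately have "v - scalar ?c f \<in> vs.span ?U" by (intro vs.span_base) simp
    then show ?thesis unfolding vs.span_breakdown_eq by blast
  qed
  then have h: "hyperplane ?U" using sub f unfolding hyperplane_def by (auto simp: Int_def)
  obtain p where p: "p \<in> forms (int (gcd_degree ?U))" "p \<noteq> 0" "is_gcd_of p ?U"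
    using hyperplane_gcd[OF h] by blast
  then have "var_y dvd p" by (auto simp: is_gcd_of_def)
  then have "1 \<le> int (gcd_degree ?U)" using form_dvd_degree[OF var_y_forms p(1,2)] by blast
  then show ?thesis using h by (intro exI[of _ ?U]) simp
qed

section \<open>The lower bound\<close>

text \<open>
  Every element of \<open>I\<^sup>t\<close> is a combination of \<open>p\<close> and \<open>f\<^sup>t\<close>. No linear factor of \<open>p\<close> divides \<open>f\<close>, since it
  would divide all of \<open>V\<close>, so the forms of this degree are not covered by such combinations.
\<close>

lemma forms_not_in_power:
  assumes U: "hyperplane U" "gcd_degree U \<ge> 1" and t: "t \<ge> 1"
  shows "\<not> forms (int d * int t + int (gcd_degree U) - 2) \<subseteq> ideal_power (ideal_gen V) t"
proof
  let ?r = "gcd_degree U"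
  assume sub: "forms (int d * int t + int ?r - 2) \<subseteq> ideal_power (ideal_gen V) t"
  obtain p where p: "p \<in> forms (int ?r)" "p \<noteq> 0" "is_gcd_of p U" using hyperplane_gcd[OF U(1)] by blast
  obtain c ls where ls: "c \<noteq> 0" "length ls = ?r" "set ls \<subseteq> lines" "p = scalar c (prod_list ls)"
    using form_factorization[OF p(1,2)] by blast
  obtain f where f: "f \<in> V" "f \<notin> U" "V \<subseteq> vs.span (insert f U)" using U(1) by (auto simp: hyperplane_def)
  have ff: "f \<in> forms (int d)" using f(1) forms by blast
  then have ft: "f ^ t \<in> forms (int (d * t))" using forms_power[of f "int d" t] by (simp add: mult.commute)
  have avoid: "\<not> l dvd f ^ t" if l: "l \<in> set ls" for l
  proof
    assume "l dvd f ^ t"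
    then have "l dvd f" using line_prime_power[of l f "int d" t] ff l ls(3) by blast
    moreover have "l dvd p" unfolding ls(4) scalar_eq_mult using line_dvd_prod_list[OF l] by (rule dvd_mult)
    then have "l dvd u" if "u \<in> U" for u using p(3) that by (auto simp: is_gcd_of_def intro: dvd_trans)
    ultimately have "l dvd 1" using f(3) dvd_span_insert[of U l f] by blast
    then show False using line_not_unit l ls(3) by blast
  qed
  have pf: "\<exists>u v. h = p * u + f * v" if "h \<in> ideal_gen V" for h
  proof -
    have "module.subspace (*) {h. \<exists>u v. h = p * u + f * v}"
    proof (rule module.subspaceI[OF module_times])
      show "0 \<in> {h. \<exists>u v. h = p * u + f * v}" by (auto intro!: exI[of _ 0])
    next
      fix x y assume "x \<in> {h. \<exists>u v. h = p * u + f * v}" "y \<in> {h. \<exists>u v. h = p * u + f * v}"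
      then obtain u v u' v' where "x = p * u + f * v" "y = p * u' + f * v'" by blast
      then have "x + y = p * (u + u') + f * (v + v')" by (simp add: algebra_simps)
      then show "x + y \<in> {h. \<exists>u v. h = p * u + f * v}" by blast
    next
      fix c x assume "x \<in> {h. \<exists>u v. h = p * u + f * v}"
      then obtain u v where "x = p * u + f * v" by blast
      then have "c * x = p * (c * u) + f * (c * v)" by (simp add: algebra_simps)
      then show "c * x \<in> {h. \<exists>u v. h = p * u + f * v}" by blast
    qed
    moreover have "V \<subseteq> {h. \<exists>u v. h = p * u + f * v}"
    proof
      fix v assume "v \<in> V"
      then obtain k where "v - scalar k f \<in> vs.span U" using f(3) vs.span_breakdown_eq by blast
      then have "v - scalar k f \<in> U" using U(1) vs.span_eq_iff unfolding hyperplane_def by blast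
      then have "p dvd v - scalar k f" using p(3) by (simp add: is_gcd_of_def)
      then obtain w where "v - scalar k f = p * w" by (rule dvdE)
      then have "v = p * w + f * [:[:k:]:]" by (simp add: scalar_eq_mult algebra_simps)
      then show "v \<in> {h. \<exists>u v. h = p * u + f * v}" by blast
    qed
    ultimately show ?thesis using ideal_gen_minimal that by blast
  qed
  have "ls \<noteq> []" using ls(2) U(2) by auto
  moreover have "d * t \<ge> 1" using degree_pos t by simp
  ultimately obtain h where h: "h \<in> forms (int (d * t) + int (length ls) - 2)"
    "\<And>u v. v \<in> forms (int (length ls) - 2) \<Longrightarrow> h \<noteq> prod_list ls * u + f ^ t * v"
    using forms_not_covered[OF _ ls(3) avoid ft] by blast
  have "h \<in> ideal_power (ideal_gen V) t" using h(1) sub ls(2) by auto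
  then obtain u v where uv: "h = p * u + f ^ t * v" using ideal_power_subset[OF pf] by blast
  let ?n = "int (d * t) + int (length ls) - 2"
  have "h = hcomp ?n h" using hcomp_same[OF h(1)] by simp
  also have "\<dots> = p * hcomp (?n - int ?r) u + f ^ t * hcomp (?n - int (d * t)) v"
    unfolding uv hcomp_add hcomp_form_mult[OF p(1)] hcomp_form_mult[OF ft] ..
  also have "p * hcomp (?n - int ?r) u = prod_list ls * scalar c (hcomp (?n - int ?r) u)"
    unfolding ls(4) by (simp add: scalar_def)
  finally have "h = prod_list ls * scalar c (hcomp (?n - int ?r) u) + f ^ t * hcomp (?n - int (d * t)) v" .
  moreover have "hcomp (?n - int (d * t)) v \<in> forms (int (length ls) - 2)"
    using hcomp_in_forms[of "?n - int (d * t)" v] by (simp add: algebra_simps)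
  ultimately show False using h(2) by blast
qed

end

section \<open>The upper bound\<close>

context base_point_free
begin

text \<open>
  The ideal \<open>I\<^sup>t + (U)\<close>; the quotients \<open>Q\<^sub>t\<close> are the forms of degree \<open>d t + r - 1\<close> modulo this ideal.
\<close>

definition power_mod :: "'a poly poly set \<Rightarrow> nat \<Rightarrow> 'a poly poly set" where
  "power_mod U t = ideal_gen (ideal_power (ideal_gen V) t \<union> U)"

lemma subspace_power_mod: "module.subspace (*) (power_mod U t)"
  unfolding power_mod_def by (rule subspace_ideal_gen)

lemma power_mod_homogeneous:
  assumes "U \<subseteq> V" "h \<in> power_mod U t"
  shows "hcomp e h \<in> power_mod U t"
  using assms(2) unfolding power_mod_def
proof (rule ideal_gen_homogeneous[rotated])
  fix u e assume u: "u \<in> ideal_power (ideal_gen V) t \<union> U"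
  have I: "hcomp e f \<in> ideal_gen V" if "f \<in> ideal_gen V" for f e
    by (rule ideal_gen_homogeneous[OF _ that]) (rule hcomp_generators[OF forms])
  show "hcomp e u \<in> ideal_gen (ideal_power (ideal_gen V) t \<union> U)"
  proof (cases "u \<in> U")
    case True
    then have "hcomp e u \<in> ideal_gen U" using assms(1) forms by (intro hcomp_generators) auto
    then show ?thesis using module.span_mono[OF module_times, of U] by blast
  next
    case False
    then have "hcomp e u \<in> ideal_power (ideal_gen V) t" using u ideal_power_homogeneous[OF I] by blast
    then show ?thesis by (intro ideal_gen_base) blast
  qed
qed

lemma power_mod_mult:
  assumes "l \<in> V" "h \<in> power_mod U t"
  shows "l * h \<in> power_mod U (Suc t)"
proof -
  let ?A = "{h. l * h \<in> power_mod U (Suc t)}"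
  have "module.subspace (*) ?A"
  proof (rule module.subspaceI[OF module_times])
    show "0 \<in> ?A" by (simp add: module.subspace_0[OF module_times subspace_power_mod])
    show "x + y \<in> ?A" if "x \<in> ?A" "y \<in> ?A" for x y
      using that by (simp add: distrib_left module.subspace_add[OF module_times subspace_power_mod])
    show "c * x \<in> ?A" if "x \<in> ?A" for c x
      using ideal_times_mult[OF subspace_power_mod, of "l * x" _ _ c] that by (simp add: mult.left_commute)
  qed
  moreover have "l * x \<in> power_mod U (Suc t)" if "x \<in> ideal_power (ideal_gen V) t" for x
    using ideal_power_mult[OF ideal_gen_base[OF assms(1)] that]
    unfolding power_mod_def by (intro ideal_gen_base) blast
  moreover have "l * x \<in> power_mod U (Suc t)" if "x \<in> U" for x
    using that unfolding power_mod_def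
    by (intro ideal_times_mult[OF subspace_ideal_gen] ideal_gen_base) blast
  ultimately have "power_mod U t \<subseteq> ?A"
    unfolding power_mod_def[of U t] by (intro ideal_gen_minimal) blast+
  then show ?thesis using assms(2) by blast
qed

text \<open>
  Modulo a hyperplane with greatest common divisor \<open>p\<close> there remain the forms modulo \<open>p\<close>, and these
  are covered by the multiples of \<open>f\<^sup>t\<close> as soon as the degree is at least \<open>d t + deg p - 1\<close>.
\<close>

lemma forms_in_power_mod_hyperplane:
  assumes U: "hyperplane U" "gcd_degree U \<le> r" "r \<ge> 1"
  shows "\<exists>T. \<forall>t\<ge>T. forms (int (d * t + r) - 1) \<subseteq> power_mod U t"
proof -
  let ?s = "gcd_degree U"
  obtain p E where p: "p \<in> forms (int ?s)" "p \<noteq> 0" "is_gcd_of p U"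
    and E: "\<And>e w. e \<ge> E \<Longrightarrow> w \<in> forms (int e) \<Longrightarrow> p * w \<in> ideal_gen U"
    using hyperplane_gcd[OF U(1)] by blast
  obtain c ls where ls: "c \<noteq> 0" "length ls = ?s" "set ls \<subseteq> lines" "p = scalar c (prod_list ls)"
    using form_factorization[OF p(1,2)] by blast
  obtain f where f: "f \<in> V" "V \<subseteq> vs.span (insert f U)" using U(1) by (auto simp: hyperplane_def)
  have ff: "f \<in> forms (int d)" using f(1) forms by blast
  have avoid: "\<not> l dvd f ^ t" if l: "l \<in> set ls" for l t
  proof
    assume "l dvd f ^ t"
    then have "l dvd f" using line_prime_power[of l f "int d" t] ff l ls(3) by blast
    moreover have "l dvd p" unfolding ls(4) scalar_eq_mult using line_dvd_prod_list[OF l] by (rule dvd_mult)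
    then have "l dvd u" if "u \<in> U" for u using p(3) that by (auto simp: is_gcd_of_def intro: dvd_trans)
    ultimately have "l dvd 1" using f(2) dvd_span_insert[of U l f] by blast
    then show False using line_not_unit l ls(3) by blast
  qed
  have "w \<in> power_mod U t" if t: "t \<ge> E + ?s" and w: "w \<in> forms (int (d * t + r) - 1)" for t w
  proof -
    define e where "e = d * t + r - 1"
    have w': "w \<in> forms (int e)" using w U(3) by (simp add: e_def of_nat_diff)
    have "f ^ t \<in> power_mod U t"
      unfolding power_mod_def by (intro ideal_gen_base UnI1 ideal_power_power f(1))
    moreover have "f ^ t \<in> forms (int (d * t))"
      using forms_power[OF ff, of t] by (simp add: mult.commute)
    moreover have "d * t + length ls \<le> e + 1" using U(2,3) ls(2) by (simp add: e_def)
    ultimately have "\<exists>u\<in>power_mod U t. \<exists>k. u \<in> forms (int k) \<and> \<not> l dvd u \<and> k + length ls \<le> e + 1"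
      if "l \<in> set ls" for l using avoid[OF that, of t] by blast
    then obtain a v where a: "a \<in> power_mod U t" and v: "v \<in> forms (int e - int (length ls))"
      "w = a + prod_list ls * v"
      using forms_covered[OF subspace_power_mod ls(3) _ w'] by blast
    have "t \<le> d * t" using degree_pos by simp
    then have "e \<ge> E + ?s" using t U(3) unfolding e_def by linarith
    then have "v \<in> forms (int (e - ?s))" "e - ?s \<ge> E" using v(1) ls(2) by (simp_all add: of_nat_diff)
    then have "p * scalar (1 / c) v \<in> ideal_gen U" by (intro E forms_scalar)
    moreover have "p * scalar (1 / c) v = prod_list ls * v"
      using ls(1) unfolding ls(4) by (simp add: scalar_def one_pCons[symmetric])
    ultimately have "prod_list ls * v \<in> power_mod U t"
      using module.span_mono[OF module_times, of U] unfolding power_mod_def by auto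
    then show ?thesis
      using module.subspace_add[OF module_times subspace_power_mod a] v(2) by simp
  qed
  then show ?thesis by blast
qed

text \<open>
  The greatest common divisor of \<open>V\<close> is a unit, so \<open>V\<close> alone generates all forms of large degree.
\<close>

lemma forms_in_power_mod_V:
  assumes "r \<ge> 1"
  shows "\<exists>T. \<forall>t\<ge>T. forms (int (d * t + r) - 1) \<subseteq> power_mod V t"
proof -
  obtain U where "hyperplane U" using hyperplane_gcd_degree_pos by blast
  then obtain u0 where u0: "u0 \<in> V" "u0 \<noteq> 0"
    using hyperplane_nonzero[of U] unfolding hyperplane_def by blast
  let ?s = "gcd_degree V"
  obtain p E where p: "p \<in> forms (int ?s)" "p \<noteq> 0" "is_gcd_of p V"
    and E: "\<And>e w. e \<ge> E \<Longrightarrow> w \<in> forms (int e) \<Longrightarrow> p * w \<in> ideal_gen V"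
    using gcd_of_forms[OF forms u0] by blast
  have p1: "p dvd 1" using p(3) common_divisor_unit by (auto simp: is_gcd_of_def)
  then have s: "?s = 0" using form_dvd_degree[OF p(1) one_in_forms] by simp
  obtain k where k: "1 = p * k" using p1 by (rule dvdE)
  then have "p * k \<in> forms 0" using one_in_forms by metis
  then have k0: "k \<in> forms 0" using form_factor[OF p(1,2), of k 0] s by simp
  have "w \<in> power_mod V t" if t: "t \<ge> E" and w: "w \<in> forms (int (d * t + r) - 1)" for t w
  proof -
    have "t \<le> d * t" using degree_pos by simp
    then have "d * t + r - 1 \<ge> E" using t assms by linarith
    moreover have "k * w \<in> forms (int (d * t + r - 1))"
      using forms_mult[OF k0 w] assms by (simp add: of_nat_diff)
    ultimately have "p * (k * w) \<in> ideal_gen V" by (rule E)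
    moreover have "p * (k * w) = w" using k by (metis mult.assoc mult_1)
    ultimately show ?thesis
      using module.span_mono[OF module_times, of V] unfolding power_mod_def by auto
  qed
  then show ?thesis by blast
qed

text \<open>
  Modulo \<open>I\<^sup>t + (U)\<close> only multiples of \<open>l\<close> are added. This turns the vanishing of the quotients for
  \<open>span (insert l U)\<close> into surjectivity of the multiplication by \<open>l\<close> on those for \<open>U\<close>.
\<close>

lemma power_mod_insert:
  assumes "h \<in> power_mod (vs.span (insert l U)) t"
  shows "\<exists>y. h - l * y \<in> power_mod U t"
proof -
  let ?A = "{h. \<exists>y. h - l * y \<in> power_mod U t}"
  have A: "module.subspace (*) ?A"
  proof (rule module.subspaceI[OF module_times])
    show "0 \<in> ?A" using module.subspace_0[OF module_times subspace_power_mod] by (auto intro: exI[of _ 0])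
    show "x + y \<in> ?A" if xy: "x \<in> ?A" "y \<in> ?A" for x y
    proof -
      obtain a b where "x - l * a \<in> power_mod U t" "y - l * b \<in> power_mod U t" using xy by blast
      then have "(x - l * a) + (y - l * b) \<in> power_mod U t"
        by (rule module.subspace_add[OF module_times subspace_power_mod])
      then have "(x + y) - l * (a + b) \<in> power_mod U t" by (simp add: algebra_simps)
      then show ?thesis by blast
    qed
    show "c * x \<in> ?A" if x: "x \<in> ?A" for c x
    proof -
      obtain a where "x - l * a \<in> power_mod U t" using x by blast
      then have "c * (x - l * a) \<in> power_mod U t" by (rule ideal_times_mult[OF subspace_power_mod])
      then have "c * x - l * (c * a) \<in> power_mod U t" by (simp add: algebra_simps)
      then show ?thesis by blast
    qed
  qed
  have base: "x \<in> ?A" if "x \<in> ideal_power (ideal_gen V) t \<union> U" for x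
    using ideal_gen_base[OF that] unfolding power_mod_def by (auto intro: exI[of _ 0])
  have "l \<in> ?A"
    using module.subspace_0[OF module_times subspace_power_mod] by (auto intro: exI[of _ 1])
  then have "vs.span (insert l U) \<subseteq> ?A"
    using base by (intro vs.span_minimal form_subspace_ideal[OF A]) auto
  then have "power_mod (vs.span (insert l U)) t \<subseteq> ?A"
    unfolding power_mod_def[of "vs.span _"] using base by (intro ideal_gen_minimal[OF A]) auto
  then show ?thesis using assms by blast
qed

text \<open>
  Descending induction on \<open>U\<close>, measured by the number of elements that span \<open>V\<close> modulo \<open>U\<close>. If \<open>U\<close>
  has codimension at least \<open>2\<close>, then every member of a pencil in \<open>V\<close> independent modulo \<open>U\<close> is
  surjective on the quotients in large degree, by induction, and the pencil argument applies.
\<close>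

lemma forms_in_power_mod:
  assumes r: "r \<ge> 1" "\<And>U. hyperplane U \<Longrightarrow> gcd_degree U \<le> r"
    and "form_subspace U" "U \<subseteq> V" "finite B" "V \<subseteq> vs.span (U \<union> B)"
  shows "\<exists>T. \<forall>t\<ge>T. forms (int (d * t + r) - 1) \<subseteq> power_mod U t"
  using assms(3-6)
proof (induction "card B" arbitrary: U B rule: less_induct)
  case less
  consider "U = V" | f where "f \<in> V" "f \<notin> U" "V \<subseteq> vs.span (insert f U)"
    | f g where "f \<in> V" "f \<notin> U" "g \<in> V" "g \<notin> vs.span (insert f U)"
    using less.prems(2) by blast
  then show ?case
  proof cases
    case 1
    then show ?thesis using forms_in_power_mod_V[OF r(1)] by simp
  next
    case 2
    then have "hyperplane U" using less.prems by (auto simp: hyperplane_def)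
    then show ?thesis using forms_in_power_mod_hyperplane r by blast
  next
    case 3
    have pencil: "l \<in> V \<and> l \<notin> U" if pl: "l \<in> insert f (range (\<lambda>s. g - scalar s f))" for l
    proof (cases "l = f")
      case False
      then obtain s where l: "l = g - scalar s f" using pl by blast
      have "l \<notin> vs.span U" using 3(4) unfolding l vs.span_breakdown_eq by blast
      then have "l \<notin> U" using vs.span_base by blast
      moreover have "l \<in> V" unfolding l by (intro vs.subspace_diff vs.subspace_scale subspace 3)
      ultimately show ?thesis by blast
    qed (use 3 in simp)
    show ?thesis
    proof (rule pencil_quotient_vanishes[where f = f and g = g])
      show "form_subspace (power_mod U t)" for t by (rule form_subspace_ideal[OF subspace_power_mod])
      show "\<exists>B. finite B \<and> forms (int (d * t + r) - 1) \<subseteq> vs.span (B :: 'a poly poly set)" for t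
        using form_subspace_finitely_spanned[OF form_subspace_forms order.refl] by blast
      fix l assume l: "l \<in> insert f (range (\<lambda>s. g - scalar s f))"
      then have lV: "l \<in> V" "l \<notin> U" using pencil by blast+
      then have lf: "l \<in> forms (int d)" using forms by blast
      show "l * h \<in> power_mod U (Suc t)" if "h \<in> power_mod U t" for t h
        using power_mod_mult[OF lV(1) that] .
      show "l * h \<in> forms (int (d * Suc t + r) - 1)" if "h \<in> forms (int (d * t + r) - 1)" for t h
        using forms_mult[OF lf that] by (simp add: algebra_simps)
      let ?U = "vs.span (insert l U)"
      have "vs.span U = U" using less.prems(1) by simp
      then obtain b where b: "b \<in> B" "vs.span (U \<union> B) \<subseteq> vs.span (insert l (U \<union> (B - {b})))"
        using vs.span_exchange[OF less.prems(3), of l U] less.prems(4) lV by blast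
      have "insert l (U \<union> (B - {b})) \<subseteq> ?U \<union> (B - {b})"
        using vs.span_superset[of "insert l U"] by blast
      then have "vs.span (insert l (U \<union> (B - {b}))) \<subseteq> vs.span (?U \<union> (B - {b}))"
        by (rule vs.span_mono)
      then have sp: "V \<subseteq> vs.span (?U \<union> (B - {b}))" using b(2) less.prems(4) by blast
      have UV: "?U \<subseteq> V" using lV(1) less.prems(2) by (intro vs.span_minimal subspace) auto
      have "card (B - {b}) < card B" using b(1) less.prems(3) by (rule card_Diff1_less[rotated])
      then obtain T where T: "\<And>t. t \<ge> T \<Longrightarrow> forms (int (d * t + r) - 1) \<subseteq> power_mod ?U t"
        using less.hyps[of "B - {b}" ?U] vs.subspace_span UV less.prems(3) sp by blast
      have "\<exists>h'\<in>forms (int (d * t + r) - 1). h - l * h' \<in> power_mod U (Suc t)"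
        if t: "t \<ge> T" and h: "h \<in> forms (int (d * Suc t + r) - 1)" for t h
      proof -
        let ?e = "int (d * Suc t + r) - 1"
        have "h \<in> power_mod ?U (Suc t)" using T[of "Suc t"] t h by auto
        then obtain y where "h - l * y \<in> power_mod U (Suc t)" using power_mod_insert by blast
        then have "hcomp ?e (h - l * y) \<in> power_mod U (Suc t)"
          by (rule power_mod_homogeneous[OF less.prems(2)])
        then have "h - l * hcomp (?e - int d) y \<in> power_mod U (Suc t)"
          unfolding hcomp_diff hcomp_form_mult[OF lf] hcomp_same[OF h] .
        moreover have "hcomp (?e - int d) y \<in> forms (int (d * t + r) - 1)"
          using hcomp_in_forms[of "?e - int d" y] by (simp add: algebra_simps)
        ultimately show ?thesis by blast
      qed
      then show "\<exists>T. \<forall>t\<ge>T. \<forall>h\<in>forms (int (d * Suc t + r) - 1).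
          \<exists>h'\<in>forms (int (d * t + r) - 1). h - l * h' \<in> power_mod U (Suc t)"
        by blast
    qed
  qed
qed

lemma forms_in_power:
  assumes "r \<ge> 1" "\<And>U. hyperplane U \<Longrightarrow> gcd_degree U \<le> r"
  shows "\<exists>T. \<forall>t\<ge>T. forms (int (d * t + r) - 1) \<subseteq> ideal_power (ideal_gen V) t"
proof -
  obtain B where B: "finite B" "V \<subseteq> vs.span B"
    using form_subspace_finitely_spanned[OF subspace forms] by blast
  then have "V \<subseteq> vs.span ({0} \<union> B)" using vs.span_mono[of B "{0} \<union> B"] by blast
  moreover have "{0} \<subseteq> V" using vs.subspace_0[OF subspace] by simp
  ultimately obtain T where T: "\<forall>t\<ge>T. forms (int (d * t + r) - 1) \<subseteq> power_mod {0} t"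
    using forms_in_power_mod[OF assms, of "{0}" B] vs.subspace_single_0 B(1) by blast
  have "power_mod {0} t \<subseteq> ideal_power (ideal_gen V) t" for t
    unfolding power_mod_def using module.subspace_0[OF module_times subspace_ideal_power]
    by (intro ideal_gen_minimal subspace_ideal_power) auto
  then show ?thesis using T by blast
qed

end

theorem corollary0p3:
  fixes V I :: "'a::alg_closed_field poly poly set" and d r :: nat
  assumes "d \<ge> 1"
    and "form_subspace V" and "V \<subseteq> forms (int d)"
    and "I = ideal_gen V"
    and "is_gcd_of 1 V"
    and "r = Max {gcd_degree V' | V'. form_subspace V' \<and> V' \<subseteq> V \<and> form_dim V = form_dim V' + 1}"
  shows "\<forall>\<^sub>F t in sequentially. ideal_regularity (ideal_power I t) = int d * int t + int r - 1"
proof -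
  interpret base_point_free V d by unfold_locales fact+
  let ?R = "{gcd_degree V' | V'. form_subspace V' \<and> V' \<subseteq> V \<and> form_dim V = form_dim V' + 1}"
  have R: "?R = gcd_degree ` {U. hyperplane U}" by (auto simp: hyperplane_dim)
  have "?R \<subseteq> {..d}"
    unfolding R by (rule image_subsetI) (simp add: gcd_degree_hyperplane_le)
  then have fin: "finite ?R" by (rule finite_subset) simp
  obtain U1 where U1: "hyperplane U1" "gcd_degree U1 \<ge> 1" using hyperplane_gcd_degree_pos by blast
  have max: "gcd_degree U \<le> r" if "hyperplane U" for U
  proof -
    have "gcd_degree U \<in> ?R" unfolding R using that by blast
    then show ?thesis unfolding assms(6) by (rule Max_ge[OF fin])
  qed
  then have r: "r \<ge> 1" using U1 le_trans by blast
  have "?R \<noteq> {}" using U1(1) unfolding R by blast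
  then have "r \<in> ?R" unfolding assms(6) using fin by (intro Max_in)
  then obtain U where U: "hyperplane U" "gcd_degree U = r" unfolding R by blast
  obtain T where T: "\<And>t. t \<ge> T \<Longrightarrow> forms (int (d * t + r) - 1) \<subseteq> ideal_power (ideal_gen V) t"
    using forms_in_power[OF r max] by blast
  have "ideal_regularity (ideal_power I t) = int d * int t + int r - 1" if t: "t \<ge> max T 1" for t
  proof (rule ideal_regularity_eq)
    show "module.subspace (*) (ideal_power I t)" by (rule subspace_ideal_power)
    have "0 \<le> int d * int t" by simp
    then show "0 \<le> int d * int t + int r - 1" using r by linarith
    show "forms (int d * int t + int r - 1) \<subseteq> ideal_power I t"
      using T[of t] t by (simp add: assms(4))
    show "\<not> forms (int d * int t + int r - 1 - 1) \<subseteq> ideal_power I t"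
      using forms_not_in_power[OF U(1), of t] U(2) r t by (simp add: assms(4))
  qed
  then show ?thesis unfolding eventually_sequentially by blast
qed

end
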